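(* In IITT, if $\Gamma\vdash t:T$ and $\Gamma\vdash t:T'$ then $\Gamma\vdash T=T'$.
   Context: Irrelevant Intensional Type Theory (IITT) is defined as follows. Sorts are $\mathsf{Set}_k$ ($k\in\mathbb{N}$), with $\mathsf{Axiom}=\{(\mathsf{Set}_i,\mathsf{Set}_{i+1})\mid i\in\mathbb{N}\}$ and $\mathsf{Rule}=\{(\mathsf{Set}_i,\mathsf{Set}_j,\mathsf{Set}_{\max(i,j)})\mid i,j\in\mathbb{N}\}$. Annotations are $\star\in\{:,\div\}$ (relevant, irrelevant). Expressions: $t,u,T,U ::= s \mid (x\star U)\to^{s,s'}T \mid x \mid \lambda x\star U.\,t \mid t\star u$, where $(x\star U)\to^{s,s'}T$ is a relevant or irrelevant dependent function type annotated with the sort $s$ of its domain and $s'$ of its codomain, and $t\star u$ is relevant application (also written $t\,u$) or irrelevant application $t\div u$. Expressions are taken modulo $\alpha$-equivalence; $[u/x]t$ is capture-avoiding substitution. Contexts: $\Gamma ::= () \mid \Gamma.\,x\star T$ (variables distinct). Resurrection $\Gamma^{\oplus}$ replaces each binding $x\div T$ by $x:T$. Abbreviations: $\Gamma\vdash t\div T$ means $\Gamma^\oplus\vdash t:T$; $\Gamma\vdash t=t'\div T$ means $\Gamma\vdash t\div T$ and $\Gamma\vdash t'\div T$; $\Gamma\vdash T$ means $\Gamma\vdash T:s$ for some sort $s$; $\Gamma\vdash T=T'$ means $\Gamma\vdash T=T':s$ for some $s$. The judgements $\vdash\Gamma$, $\Gamma\vdash t:T$, $\Gamma\vdash t=t':T$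 are defined mutually inductively by: (contexts) $\vdash()$; from $\vdash\Gamma$ and $\Gamma\vdash T$ infer $\vdash\Gamma.x\star T$. (typing) from $\vdash\Gamma$, $(s,s')\in\mathsf{Axiom}$ infer $\Gamma\vdash s:s'$; from $\Gamma\vdash U:s_1$, $\Gamma.x\star U\vdash T:s_2$, $(s_1,s_2,s_3)\in\mathsf{Rule}$ infer $\Gamma\vdash (x\star U)\to^{s_1,s_2}T:s_3$; from $\vdash\Gamma$ and $(x:U)\in\Gamma$ infer $\Gamma\vdash x:U$ (no variable rule for irrelevant bindings); from $\Gamma.x\star U\vdash t:T$ and $\Gamma\vdash (x\star U)\to^{s,s'}T$ infer $\Gamma\vdash \lambda x\star U.t:(x\star U)\to^{s,s'}T$; from $\Gamma\vdash t:(x\star U)\to^{s,s'}T$ and $\Gamma\vdash u\star U$ infer $\Gamma\vdash t\star u:[u/x]T$; from $\Gamma\vdash t:T$ and $\Gamma\vdash T=T'$ infer $\Gamma\vdash t:T'$. (equality) $\beta$: from $\Gamma.x\star U\vdash t:T$ and $\Gamma\vdash u\star U$ infer $\Gamma\vdash(\lambda x\star U.t)\star u=[u/x]t:[u/x]T$; $\eta$: from $\Gamma\vdash t:(x\star U)\to^{s,s'}T$ infer $\Gamma\vdash t=\lambda x\star U.(t\star x):(x\star U)\to^{s,s'}T$; reflexivity, symmetry, transitivity; from $\Gamma\vdash U=U':s_1$, $\Gamma.x\star U\vdash T=T':s_2$, $(s_1,s_2,s_3)\in\mathsf{Rule}$ infer $\Gamma\vdash (x\star U)\to^{s_1,s_2}T=(x\star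 U')\to^{s_1,s_2}T':s_3$; from $\Gamma\vdash U=U':s_1$, $\Gamma.x\star U\vdash T:s_2$, $\Gamma.x\star U\vdash t=t':T$ infer $\Gamma\vdash\lambda x\star U.t=\lambda x\star U'.t':(x\star U)\to^{s_1,s_2}T$; from $\Gamma\vdash t=t':(x\star U)\to^{s,s'}T$ and $\Gamma\vdash u=u'\star U$ infer $\Gamma\vdash t\star u=t'\star u':[u/x]T$; from $\Gamma\vdash t=t':T$ and $\Gamma\vdash T=T'$ infer $\Gamma\vdash t=t':T'$. *)

theory Defs
  imports Main
begin

datatype sort = Set nat

definition Axiom :: "(sort \<times> sort) set" where
  "Axiom = {(Set i, Set (i + 1)) | i. True}"

definition Rule :: "(sort \<times> sort \<times> sort) set" where
  "Rule = {(Set i, Set j, Set (max i j)) | i j. True}"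

datatype ann = Relevant | Irrelevant

text \<open>
  Expressions modulo alpha-equivalence are represented with de Bruijn indices: the last argument
  of \<^term>\<open>Pi\<close> and \<^term>\<open>Lam\<close> is the scope of the bound variable, which has index 0 there.
  \<^term>\<open>Pi a s s' U T\<close> is the function type annotated with the sort \<^term>\<open>s\<close> of its
  domain \<^term>\<open>U\<close> and the sort \<^term>\<open>s'\<close> of its codomain \<^term>\<open>T\<close>.
\<close>

datatype exp =
    Sort sort
  | Pi ann sort sort exp exp
  | Var nat
  | Lam ann exp exp
  | App ann exp exp

primrec lift_ren :: "(nat \<Rightarrow> nat) \<Rightarrow> nat \<Rightarrow> nat" where
  "lift_ren \<rho> 0 = 0"
| "lift_ren \<rho> (Suc n) = Suc (\<rho> n)"

primrec ren :: "(nat \<Rightarrow> nat) \<Rightarrow> exp \<Rightarrow> exp" where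
  "ren \<rho> (Sort s) = Sort s"
| "ren \<rho> (Pi a s s' U T) = Pi a s s' (ren \<rho> U) (ren (lift_ren \<rho>) T)"
| "ren \<rho> (Var n) = Var (\<rho> n)"
| "ren \<rho> (Lam a U t) = Lam a (ren \<rho> U) (ren (lift_ren \<rho>) t)"
| "ren \<rho> (App a t u) = App a (ren \<rho> t) (ren \<rho> u)"

primrec lift_sub :: "(nat \<Rightarrow> exp) \<Rightarrow> nat \<Rightarrow> exp" where
  "lift_sub \<sigma> 0 = Var 0"
| "lift_sub \<sigma> (Suc n) = ren Suc (\<sigma> n)"

primrec sub :: "(nat \<Rightarrow> exp) \<Rightarrow> exp \<Rightarrow> exp" where
  "sub \<sigma> (Sort s) = Sort s"
| "sub \<sigma> (Pi a s s' U T) = Pi a s s' (sub \<sigma> U) (sub (lift_sub \<sigma>) T)"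
| "sub \<sigma> (Var n) = \<sigma> n"
| "sub \<sigma> (Lam a U t) = Lam a (sub \<sigma> U) (sub (lift_sub \<sigma>) t)"
| "sub \<sigma> (App a t u) = App a (sub \<sigma> t) (sub \<sigma> u)"

text \<open>
  \<^term>\<open>inst u t\<close> is the substitution of \<^term>\<open>u\<close> for the variable with index 0
  in \<^term>\<open>t\<close>; the remaining free variables move down by one, since its binder disappears.
\<close>

definition inst :: "exp \<Rightarrow> exp \<Rightarrow> exp" where
  "inst u t = sub (\<lambda>n. case n of 0 \<Rightarrow> u | Suc m \<Rightarrow> Var m) t"

text \<open>
  The most recent binding is the head of the list, so index \<^term>\<open>n\<close> refers to the
  \<^term>\<open>n\<close>-th entry. Each type lives in the context formed by the tail behind its entry.
\<close>

type_synonym ctx = "(ann \<times> exp) list"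

definition resurrect :: "ctx \<Rightarrow> ctx" where
  "resurrect \<Gamma> = map (\<lambda>(a, T). (Relevant, T)) \<Gamma>"

text \<open>
  The annotated judgement \<open>\<Gamma> \<turnstile> t \<star> T\<close> is ordinary typing of \<open>t\<close> in \<open>ctx_for \<star> \<Gamma>\<close>.
\<close>

primrec ctx_for :: "ann \<Rightarrow> ctx \<Rightarrow> ctx" where
  "ctx_for Relevant \<Gamma> = \<Gamma>"
| "ctx_for Irrelevant \<Gamma> = resurrect \<Gamma>"

text \<open>
  Premises \<open>\<Gamma> \<turnstile> T\<close> and \<open>\<Gamma> \<turnstile> T = T'\<close> are unfolded to judgements at some sort. Congruence of
  application is split into \<open>eq_app\<close> and \<open>eq_app_irr\<close> because \<open>\<Gamma> \<turnstile> u = u' \<div> U\<close>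
  abbreviates a pair of typing judgements.
\<close>

inductive
  wf_ctx :: "ctx \<Rightarrow> bool" ("\<turnstile> _" [50] 50) and
  has_type :: "ctx \<Rightarrow> exp \<Rightarrow> exp \<Rightarrow> bool" ("_ \<turnstile> _ \<^bold>: _" [50, 50, 50] 50) and
  eq_tm :: "ctx \<Rightarrow> exp \<Rightarrow> exp \<Rightarrow> exp \<Rightarrow> bool" ("_ \<turnstile> _ \<^bold>= _ \<^bold>: _" [50, 50, 50, 50] 50)
where
  wf_empty: "\<turnstile> []"
| wf_extend: "\<lbrakk>\<turnstile> \<Gamma>; \<Gamma> \<turnstile> T \<^bold>: Sort s\<rbrakk> \<Longrightarrow> \<turnstile> (a, T) # \<Gamma>"

| ty_sort: "\<lbrakk>\<turnstile> \<Gamma>; (s, s') \<in> Axiom\<rbrakk> \<Longrightarrow> \<Gamma> \<turnstile> Sort s \<^bold>: Sort s'"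
| ty_pi: "\<lbrakk>\<Gamma> \<turnstile> U \<^bold>: Sort s1; (a, U) # \<Gamma> \<turnstile> T \<^bold>: Sort s2; (s1, s2, s3) \<in> Rule\<rbrakk>
    \<Longrightarrow> \<Gamma> \<turnstile> Pi a s1 s2 U T \<^bold>: Sort s3"
| ty_var: "\<lbrakk>\<turnstile> \<Gamma>; n < length \<Gamma>; \<Gamma> ! n = (Relevant, U)\<rbrakk>
    \<Longrightarrow> \<Gamma> \<turnstile> Var n \<^bold>: ren (\<lambda>m. m + Suc n) U"
| ty_lam: "\<lbrakk>(a, U) # \<Gamma> \<turnstile> t \<^bold>: T; \<Gamma> \<turnstile> Pi a s s' U T \<^bold>: Sort s''\<rbrakk>
    \<Longrightarrow> \<Gamma> \<turnstile> Lam a U t \<^bold>: Pi a s s' U T"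
| ty_app: "\<lbrakk>\<Gamma> \<turnstile> t \<^bold>: Pi a s s' U T; ctx_for a \<Gamma> \<turnstile> u \<^bold>: U\<rbrakk>
    \<Longrightarrow> \<Gamma> \<turnstile> App a t u \<^bold>: inst u T"
| ty_conv: "\<lbrakk>\<Gamma> \<turnstile> t \<^bold>: T; \<Gamma> \<turnstile> T \<^bold>= T' \<^bold>: Sort s\<rbrakk> \<Longrightarrow> \<Gamma> \<turnstile> t \<^bold>: T'"

| eq_beta: "\<lbrakk>(a, U) # \<Gamma> \<turnstile> t \<^bold>: T; ctx_for a \<Gamma> \<turnstile> u \<^bold>: U\<rbrakk>
    \<Longrightarrow> \<Gamma> \<turnstile> App a (Lam a U t) u \<^bold>= inst u t \<^bold>: inst u T"
| eq_eta: "\<Gamma> \<turnstile> t \<^bold>: Pi a s s' U T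
    \<Longrightarrow> \<Gamma> \<turnstile> t \<^bold>= Lam a U (App a (ren Suc t) (Var 0)) \<^bold>: Pi a s s' U T"
| eq_refl: "\<Gamma> \<turnstile> t \<^bold>: T \<Longrightarrow> \<Gamma> \<turnstile> t \<^bold>= t \<^bold>: T"
| eq_sym: "\<Gamma> \<turnstile> t \<^bold>= t' \<^bold>: T \<Longrightarrow> \<Gamma> \<turnstile> t' \<^bold>= t \<^bold>: T"
| eq_trans: "\<lbrakk>\<Gamma> \<turnstile> t1 \<^bold>= t2 \<^bold>: T; \<Gamma> \<turnstile> t2 \<^bold>= t3 \<^bold>: T\<rbrakk> \<Longrightarrow> \<Gamma> \<turnstile> t1 \<^bold>= t3 \<^bold>: T"
| eq_pi: "\<lbrakk>\<Gamma> \<turnstile> U \<^bold>= U' \<^bold>: Sort s1; (a, U) # \<Gamma> \<turnstile> T \<^bold>= T' \<^bold>: Sort s2; (s1, s2, s3) \<in> Rule\<rbrakk>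
    \<Longrightarrow> \<Gamma> \<turnstile> Pi a s1 s2 U T \<^bold>= Pi a s1 s2 U' T' \<^bold>: Sort s3"
| eq_lam: "\<lbrakk>\<Gamma> \<turnstile> U \<^bold>= U' \<^bold>: Sort s1; (a, U) # \<Gamma> \<turnstile> T \<^bold>: Sort s2; (a, U) # \<Gamma> \<turnstile> t \<^bold>= t' \<^bold>: T\<rbrakk>
    \<Longrightarrow> \<Gamma> \<turnstile> Lam a U t \<^bold>= Lam a U' t' \<^bold>: Pi a s1 s2 U T"
| eq_app: "\<lbrakk>\<Gamma> \<turnstile> t \<^bold>= t' \<^bold>: Pi Relevant s s' U T; \<Gamma> \<turnstile> u \<^bold>= u' \<^bold>: U\<rbrakk>
    \<Longrightarrow> \<Gamma> \<turnstile> App Relevant t u \<^bold>= App Relevant t' u' \<^bold>: inst u T"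
| eq_app_irr: "\<lbrakk>\<Gamma> \<turnstile> t \<^bold>= t' \<^bold>: Pi Irrelevant s s' U T;
      resurrect \<Gamma> \<turnstile> u \<^bold>: U; resurrect \<Gamma> \<turnstile> u' \<^bold>: U\<rbrakk>
    \<Longrightarrow> \<Gamma> \<turnstile> App Irrelevant t u \<^bold>= App Irrelevant t' u' \<^bold>: inst u T"
| eq_conv: "\<lbrakk>\<Gamma> \<turnstile> t \<^bold>= t' \<^bold>: T; \<Gamma> \<turnstile> T \<^bold>= T' \<^bold>: Sort s\<rbrakk> \<Longrightarrow> \<Gamma> \<turnstile> t \<^bold>= t' \<^bold>: T'"

definition eq_ty :: "ctx \<Rightarrow> exp \<Rightarrow> exp \<Rightarrow> bool" ("_ \<turnstile> _ \<^bold>= _" [50, 50, 50] 50) where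
  "\<Gamma> \<turnstile> T \<^bold>= T' \<longleftrightarrow> (\<exists>s. \<Gamma> \<turnstile> T \<^bold>= T' \<^bold>: Sort s)"

end

theory Submission
  imports Defs
begin

text \<open>
  Two types of the same term can be compared along its structure once function types are
  injective: in the case of an application the types of the function are equal, and their
  codomains must be too. Injectivity comes from a logical relation on types and terms that
  compares weak head normal forms and also records that domains and codomains are judgementally
  equal; all typable equations preserve it. An irrelevant variable never occurs in a position
  that is evaluated, so an irrelevant argument only has to be well-typed, and the relation can be
  set up in one fixed context instead of over all its extensions.

  Neither the sort of a type nor transitivity of equality across different sorts is known at
  first. Uniqueness is therefore shown up to chains of type equalities, first for neutral terms;
  subject reduction carries uniqueness of sorts from weak head normal forms to all types, and then
  every chain collapses to one equation.
\<close>


section \<open>Substitution calculus\<close>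

text \<open>Which types are related and how their elements are related depend on each other, and the
  element relation of a domain stands to the left of an implication in the clause for function
  types. \<open>LR\<close> therefore carries the element relation as an argument of an inductive
  predicate on types, and \<open>LR_unique\<close> shows afterwards that the left type alone
  determines it; this replaces a recursion over types. Universes are then added by recursion on the
  level, which works because \<open>Rule\<close> is predicative: \<open>max i j\<close> bounds
  domain and codomain.

  Relating two codomains at all arguments from one fixed context gives no equation between the open
  codomains. That equation, over the context extended by the domain, is a clause of its own. The
  fundamental theorem obtains it from functionality (equal substitutions give equal results), so
  functionality has to be proved syntactically before any model is available.\<close>

definition scons :: "exp \<Rightarrow> (nat \<Rightarrow> exp) \<Rightarrow> nat \<Rightarrow> exp" where
  "scons u \<sigma> = (\<lambda>n. case n of 0 \<Rightarrow> u | Suc m \<Rightarrow> \<sigma> m)"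

lemma scons_simps [simp]:
  "scons u \<sigma> 0 = u" "scons u \<sigma> (Suc n) = \<sigma> n" "scons u \<sigma> \<circ> Suc = \<sigma>"
  by (auto simp: scons_def)

lemma inst_scons: "inst u t = sub (scons u Var) t"
  by (simp add: inst_def scons_def)

lemma lift_ren_comp: "lift_ren \<rho> \<circ> lift_ren \<rho>' = lift_ren (\<rho> \<circ> \<rho>')"
proof
  fix n show "(lift_ren \<rho> \<circ> lift_ren \<rho>') n = lift_ren (\<rho> \<circ> \<rho>') n" by (cases n) auto
qed

lemma ren_ren: "ren \<rho> (ren \<rho>' t) = ren (\<rho> \<circ> \<rho>') t"
  by (induction t arbitrary: \<rho> \<rho>') (auto simp: lift_ren_comp)

lemma lift_sub_ren: "lift_sub \<sigma> \<circ> lift_ren \<rho> = lift_sub (\<sigma> \<circ> \<rho>)"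
proof
  fix n show "(lift_sub \<sigma> \<circ> lift_ren \<rho>) n = lift_sub (\<sigma> \<circ> \<rho>) n" by (cases n) auto
qed

lemma sub_ren: "sub \<sigma> (ren \<rho> t) = sub (\<sigma> \<circ> \<rho>) t"
  by (induction t arbitrary: \<sigma> \<rho>) (auto simp: lift_sub_ren)

lemma lift_ren_sub: "ren (lift_ren \<rho>) \<circ> lift_sub \<sigma> = lift_sub (ren \<rho> \<circ> \<sigma>)"
proof
  fix n show "(ren (lift_ren \<rho>) \<circ> lift_sub \<sigma>) n = lift_sub (ren \<rho> \<circ> \<sigma>) n"
    by (cases n) (auto simp: ren_ren comp_def)
qed

lemma ren_sub: "ren \<rho> (sub \<sigma> t) = sub (ren \<rho> \<circ> \<sigma>) t"
  by (induction t arbitrary: \<sigma> \<rho>) (auto simp: lift_ren_sub)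

lemma lift_sub_comp: "sub (lift_sub \<sigma>) \<circ> lift_sub \<sigma>' = lift_sub (sub \<sigma> \<circ> \<sigma>')"
proof
  fix n show "(sub (lift_sub \<sigma>) \<circ> lift_sub \<sigma>') n = lift_sub (sub \<sigma> \<circ> \<sigma>') n"
    by (cases n) (auto simp: ren_sub sub_ren comp_def)
qed

text \<open>Under a binder \<open>ren Suc\<close> has to be pushed through a substitution, so the
  mixed laws \<open>sub_ren\<close> and \<open>ren_sub\<close> come first, and
  \<open>ren_sub\<close> in turn rests on \<open>ren_ren\<close>.\<close>

lemma sub_sub: "sub \<sigma> (sub \<sigma>' t) = sub (sub \<sigma> \<circ> \<sigma>') t"
  by (induction t arbitrary: \<sigma> \<sigma>') (auto simp: lift_sub_comp)

lemma lift_sub_id [simp]: "lift_sub Var = Var"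
proof
  fix n show "lift_sub Var n = Var n" by (cases n) auto
qed

lemma lift_sub_Var: "lift_sub (Var \<circ> \<rho>) = Var \<circ> lift_ren \<rho>"
proof
  fix n show "lift_sub (Var \<circ> \<rho>) n = (Var \<circ> lift_ren \<rho>) n" by (cases n) auto
qed

lemma ren_eq_sub: "ren \<rho> t = sub (Var \<circ> \<rho>) t"
  by (induction t arbitrary: \<rho>) (auto simp: lift_sub_Var)

lemma ren_id: "ren id t = t"
proof -
  have "lift_ren id = id"
  proof
    fix n show "lift_ren id n = id n" by (cases n) auto
  qed
  then show ?thesis by (induction t) auto
qed

lemma sub_Var [simp]: "sub Var t = t"
  using ren_eq_sub[of id t] by (simp add: ren_id)

lemma sub_scons_Suc [simp]: "sub (scons u \<sigma>) (ren Suc t) = sub \<sigma> t"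
  by (simp add: sub_ren)

lemma sub_lift_Suc: "sub (lift_sub \<sigma>) (ren Suc t) = ren Suc (sub \<sigma> t)"
  by (simp add: sub_ren ren_sub comp_def)

lemma ren_lift_Suc: "ren (lift_ren \<rho>) (ren Suc t) = ren Suc (ren \<rho> t)"
  by (simp add: ren_ren comp_def)

lemma inst_ren_Suc [simp]: "inst u (ren Suc t) = t"
  by (simp add: inst_scons)

text \<open>In the model a codomain appears substituted under its binder and then instantiated;
  hypotheses about the codomain speak of a substitution extended by the argument. This equation
  links the two.\<close>

lemma inst_sub_lift: "inst u (sub (lift_sub \<sigma>) t) = sub (scons u \<sigma>) t"
proof -
  have "sub (scons u Var) \<circ> lift_sub \<sigma> = scons u \<sigma>"
  proof
    fix n show "(sub (scons u Var) \<circ> lift_sub \<sigma>) n = scons u \<sigma> n" by (cases n) auto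
  qed
  then show ?thesis by (simp add: inst_scons sub_sub)
qed

lemma sub_inst: "sub \<sigma> (inst u t) = sub (scons (sub \<sigma> u) \<sigma>) t"
proof -
  have "sub \<sigma> \<circ> scons u Var = scons (sub \<sigma> u) \<sigma>"
  proof
    fix n show "(sub \<sigma> \<circ> scons u Var) n = scons (sub \<sigma> u) \<sigma> n" by (cases n) auto
  qed
  then show ?thesis by (simp add: inst_scons sub_sub)
qed

lemma sub_inst_lift: "sub \<sigma> (inst u t) = inst (sub \<sigma> u) (sub (lift_sub \<sigma>) t)"
  by (simp add: inst_sub_lift sub_inst)

lemma ren_inst: "ren \<rho> (inst u t) = inst (ren \<rho> u) (ren (lift_ren \<rho>) t)"
  by (simp add: ren_eq_sub sub_inst_lift lift_sub_Var)

text \<open>Serves eta: the expanded body applies the weakened function to the new variable, and its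
  type comes out as the renamed codomain instantiated with \<open>Var 0\<close>.\<close>

lemma inst_Var0 [simp]: "inst (Var 0) (ren (lift_ren Suc) t) = t"
proof -
  have "scons (Var 0) Var \<circ> lift_ren Suc = Var"
  proof
    fix n show "(scons (Var 0) Var \<circ> lift_ren Suc) n = Var n" by (cases n) auto
  qed
  then show ?thesis by (simp add: inst_scons sub_ren)
qed


section \<open>A presentation with redundant premises\<close>

text \<open>Shifting the type once per binding passed turns context extension into a rule and suits
  induction on contexts. Irrelevant bindings are found as well, because renamings and substitutions
  must treat them too.\<close>

inductive lookup :: "ctx \<Rightarrow> nat \<Rightarrow> ann \<Rightarrow> exp \<Rightarrow> bool" where
  lookup_0: "lookup ((a, U) # \<Gamma>) 0 a (ren Suc U)"
| lookup_Suc: "lookup \<Gamma> n a T \<Longrightarrow> lookup (X # \<Gamma>) (Suc n) a (ren Suc T)"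

inductive_cases lookup_ConsE: "lookup (X # \<Gamma>) n a T"
inductive_cases lookup_NilE: "lookup [] n a T"

lemma lookup_nth: "lookup \<Gamma> n a T \<longleftrightarrow> n < length \<Gamma> \<and> (\<exists>U. \<Gamma> ! n = (a, U) \<and> T = ren (\<lambda>m. m + Suc n) U)"
proof (induction \<Gamma> arbitrary: n T)
  case Nil
  then show ?case by (auto elim: lookup_NilE)
next
  case (Cons X \<Gamma>)
  show ?case
  proof (cases n)
    case 0
    have "Suc = (\<lambda>m. m + Suc 0)" by auto
    then show ?thesis using 0 by (cases X) (auto elim: lookup_ConsE intro: lookup_0)
  next
    case (Suc k)
    have "lookup (X # \<Gamma>) (Suc k) a T \<longleftrightarrow> (\<exists>T'. lookup \<Gamma> k a T' \<and> T = ren Suc T')"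
      by (auto elim: lookup_ConsE intro: lookup_Suc)
    then show ?thesis using Cons.IH Suc by (auto simp: ren_ren comp_def)
  qed
qed

text \<open>
  Every rule that mentions a function type also assumes that its domain and codomain are
  well-formed. With these premises functionality of substitution can be shown by induction
  on typing before it is known that the types in a derivable judgement are well-formed.
\<close>

inductive
  wfc :: "ctx \<Rightarrow> bool" ("\<tturnstile> _" [50] 50) and
  wty :: "ctx \<Rightarrow> exp \<Rightarrow> exp \<Rightarrow> bool" ("_ \<tturnstile> _ \<^bold>: _" [50, 50, 50] 50) and
  cnv :: "ctx \<Rightarrow> exp \<Rightarrow> exp \<Rightarrow> exp \<Rightarrow> bool" ("_ \<tturnstile> _ \<^bold>= _ \<^bold>: _" [50, 50, 50, 50] 50)
where
  wfc_empty: "\<tturnstile> []"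
| wfc_extend: "\<lbrakk>\<tturnstile> \<Gamma>; \<Gamma> \<tturnstile> T \<^bold>: Sort s\<rbrakk> \<Longrightarrow> \<tturnstile> (a, T) # \<Gamma>"

| typ_sort: "\<tturnstile> \<Gamma> \<Longrightarrow> \<Gamma> \<tturnstile> Sort (Set i) \<^bold>: Sort (Set (Suc i))"
| typ_pi: "\<lbrakk>\<Gamma> \<tturnstile> U \<^bold>: Sort (Set i); (a, U) # \<Gamma> \<tturnstile> T \<^bold>: Sort (Set j)\<rbrakk>
    \<Longrightarrow> \<Gamma> \<tturnstile> Pi a (Set i) (Set j) U T \<^bold>: Sort (Set (max i j))"
| typ_var: "\<lbrakk>\<tturnstile> \<Gamma>; lookup \<Gamma> n Relevant T\<rbrakk> \<Longrightarrow> \<Gamma> \<tturnstile> Var n \<^bold>: T"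
| typ_lam: "\<lbrakk>\<Gamma> \<tturnstile> U \<^bold>: Sort s; (a, U) # \<Gamma> \<tturnstile> T \<^bold>: Sort s'; (a, U) # \<Gamma> \<tturnstile> t \<^bold>: T\<rbrakk>
    \<Longrightarrow> \<Gamma> \<tturnstile> Lam a U t \<^bold>: Pi a s s' U T"
| typ_app: "\<lbrakk>\<Gamma> \<tturnstile> U \<^bold>: Sort s; (a, U) # \<Gamma> \<tturnstile> T \<^bold>: Sort s';
      \<Gamma> \<tturnstile> t \<^bold>: Pi a s s' U T; ctx_for a \<Gamma> \<tturnstile> u \<^bold>: U\<rbrakk>
    \<Longrightarrow> \<Gamma> \<tturnstile> App a t u \<^bold>: inst u T"
| typ_conv: "\<lbrakk>\<Gamma> \<tturnstile> t \<^bold>: T; \<Gamma> \<tturnstile> T \<^bold>= T' \<^bold>: Sort s\<rbrakk> \<Longrightarrow> \<Gamma> \<tturnstile> t \<^bold>: T'"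

| cnv_beta: "\<lbrakk>\<Gamma> \<tturnstile> U \<^bold>: Sort s; (a, U) # \<Gamma> \<tturnstile> T \<^bold>: Sort s';
      (a, U) # \<Gamma> \<tturnstile> t \<^bold>: T; ctx_for a \<Gamma> \<tturnstile> u \<^bold>: U\<rbrakk>
    \<Longrightarrow> \<Gamma> \<tturnstile> App a (Lam a U t) u \<^bold>= inst u t \<^bold>: inst u T"
| cnv_eta: "\<lbrakk>\<Gamma> \<tturnstile> U \<^bold>: Sort s; (a, U) # \<Gamma> \<tturnstile> T \<^bold>: Sort s'; \<Gamma> \<tturnstile> t \<^bold>: Pi a s s' U T\<rbrakk>
    \<Longrightarrow> \<Gamma> \<tturnstile> t \<^bold>= Lam a U (App a (ren Suc t) (Var 0)) \<^bold>: Pi a s s' U T"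
| cnv_refl: "\<Gamma> \<tturnstile> t \<^bold>: T \<Longrightarrow> \<Gamma> \<tturnstile> t \<^bold>= t \<^bold>: T"
| cnv_sym: "\<Gamma> \<tturnstile> t \<^bold>= t' \<^bold>: T \<Longrightarrow> \<Gamma> \<tturnstile> t' \<^bold>= t \<^bold>: T"
| cnv_trans: "\<lbrakk>\<Gamma> \<tturnstile> t1 \<^bold>= t2 \<^bold>: T; \<Gamma> \<tturnstile> t2 \<^bold>= t3 \<^bold>: T\<rbrakk> \<Longrightarrow> \<Gamma> \<tturnstile> t1 \<^bold>= t3 \<^bold>: T"
| cnv_pi: "\<lbrakk>\<Gamma> \<tturnstile> U \<^bold>: Sort (Set i); \<Gamma> \<tturnstile> U \<^bold>= U' \<^bold>: Sort (Set i);
      (a, U) # \<Gamma> \<tturnstile> T \<^bold>= T' \<^bold>: Sort (Set j)\<rbrakk>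
    \<Longrightarrow> \<Gamma> \<tturnstile> Pi a (Set i) (Set j) U T \<^bold>= Pi a (Set i) (Set j) U' T' \<^bold>: Sort (Set (max i j))"
| cnv_lam: "\<lbrakk>\<Gamma> \<tturnstile> U \<^bold>: Sort s; \<Gamma> \<tturnstile> U \<^bold>= U' \<^bold>: Sort s;
      (a, U) # \<Gamma> \<tturnstile> T \<^bold>: Sort s'; (a, U) # \<Gamma> \<tturnstile> t \<^bold>= t' \<^bold>: T\<rbrakk>
    \<Longrightarrow> \<Gamma> \<tturnstile> Lam a U t \<^bold>= Lam a U' t' \<^bold>: Pi a s s' U T"
| cnv_app: "\<lbrakk>\<Gamma> \<tturnstile> U \<^bold>: Sort s; (Relevant, U) # \<Gamma> \<tturnstile> T \<^bold>: Sort s';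
      \<Gamma> \<tturnstile> t \<^bold>= t' \<^bold>: Pi Relevant s s' U T; \<Gamma> \<tturnstile> u \<^bold>= u' \<^bold>: U\<rbrakk>
    \<Longrightarrow> \<Gamma> \<tturnstile> App Relevant t u \<^bold>= App Relevant t' u' \<^bold>: inst u T"
| cnv_app_irr: "\<lbrakk>\<Gamma> \<tturnstile> U \<^bold>: Sort s; (Irrelevant, U) # \<Gamma> \<tturnstile> T \<^bold>: Sort s';
      \<Gamma> \<tturnstile> t \<^bold>= t' \<^bold>: Pi Irrelevant s s' U T;
      resurrect \<Gamma> \<tturnstile> u \<^bold>: U; resurrect \<Gamma> \<tturnstile> u' \<^bold>: U\<rbrakk>
    \<Longrightarrow> \<Gamma> \<tturnstile> App Irrelevant t u \<^bold>= App Irrelevant t' u' \<^bold>: inst u T"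
| cnv_conv: "\<lbrakk>\<Gamma> \<tturnstile> t \<^bold>= t' \<^bold>: T; \<Gamma> \<tturnstile> T \<^bold>= T' \<^bold>: Sort s\<rbrakk> \<Longrightarrow> \<Gamma> \<tturnstile> t \<^bold>= t' \<^bold>: T'"

inductive_cases wfc_ConsE: "\<tturnstile> (a, U) # \<Gamma>"

lemma typ_wfc: "\<Gamma> \<tturnstile> t \<^bold>: T \<Longrightarrow> \<tturnstile> \<Gamma>"
  and cnv_wfc: "\<Gamma> \<tturnstile> t \<^bold>= t' \<^bold>: T \<Longrightarrow> \<tturnstile> \<Gamma>"
  by (induction rule: wfc_wty_cnv.inducts(2,3)[where ?P1.0="\<lambda>_. True"])
    (auto elim: wfc_ConsE)


section \<open>Renaming and substitution\<close>

lemma resurrect_simps [simp]: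
  "resurrect [] = []" "resurrect ((a, U) # \<Gamma>) = (Relevant, U) # resurrect \<Gamma>"
  "resurrect (resurrect \<Gamma>) = resurrect \<Gamma>"
  by (auto simp: resurrect_def)

lemma lookup_resurrectI: "lookup \<Gamma> n a T \<Longrightarrow> lookup (resurrect \<Gamma>) n Relevant T"
  by (induction rule: lookup.induct) (auto simp: resurrect_def intro: lookup.intros)

lemma lookup_resurrectD: "lookup (resurrect \<Gamma>) n a T \<Longrightarrow> a = Relevant \<and> (\<exists>b. lookup \<Gamma> n b T)"
  by (induction "resurrect \<Gamma>" n a T arbitrary: \<Gamma> rule: lookup.induct)
    (fastforce simp: resurrect_def intro: lookup.intros)+

text \<open>A binding may become relevant but never irrelevant. Resurrection is therefore covered as
  the renaming \<open>id\<close>.\<close>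

definition renames :: "ctx \<Rightarrow> (nat \<Rightarrow> nat) \<Rightarrow> ctx \<Rightarrow> bool" where
  "renames \<Delta> \<rho> \<Gamma> \<longleftrightarrow> (\<forall>n a T. lookup \<Gamma> n a T \<longrightarrow>
     (\<exists>b. lookup \<Delta> (\<rho> n) b (ren \<rho> T) \<and> (a = Relevant \<longrightarrow> b = Relevant)))"

lemma renames_lift: "renames \<Delta> \<rho> \<Gamma> \<Longrightarrow> renames ((a, ren \<rho> U) # \<Delta>) (lift_ren \<rho>) ((a, U) # \<Gamma>)"
  unfolding renames_def
  by (fastforce simp: ren_lift_Suc elim!: lookup_ConsE intro: lookup.intros)

lemma renames_resurrect: "renames \<Delta> \<rho> \<Gamma> \<Longrightarrow> renames (resurrect \<Delta>) \<rho> (resurrect \<Gamma>)"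
  unfolding renames_def by (meson lookup_resurrectI lookup_resurrectD)

lemma renames_to_resurrect: "renames \<Delta> \<rho> \<Gamma> \<Longrightarrow> renames (resurrect \<Delta>) \<rho> \<Gamma>"
  unfolding renames_def by (blast intro: lookup_resurrectI)

lemma renames_ctx_for: "renames \<Delta> \<rho> \<Gamma> \<Longrightarrow> renames (ctx_for a \<Delta>) \<rho> (ctx_for a \<Gamma>)"
  by (cases a) (auto intro: renames_resurrect)

lemma renames_id: "renames \<Gamma> id \<Gamma>"
  by (auto simp: renames_def ren_id)

lemma renames_Suc: "renames (X # \<Gamma>) Suc \<Gamma>"
  by (auto simp: renames_def intro: lookup_Suc)

text \<open>Renaming an irrelevant argument leads into the resurrected target context, whose
  well-formedness is itself a consequence of renaming. Assuming both contexts well-formed breaks the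
  circle; \<open>wfc_resurrect\<close> then makes the second half automatic.\<close>

definition wfc2 :: "ctx \<Rightarrow> bool" where
  "wfc2 \<Gamma> \<longleftrightarrow> \<tturnstile> \<Gamma> \<and> \<tturnstile> resurrect \<Gamma>"

lemma wfc2_resurrect: "wfc2 \<Delta> \<Longrightarrow> wfc2 (resurrect \<Delta>)"
  by (auto simp: wfc2_def)

lemma wfc2_ctx_for: "wfc2 \<Delta> \<Longrightarrow> wfc2 (ctx_for a \<Delta>)"
  by (cases a) (auto intro: wfc2_resurrect)

text \<open>The last assumption is an induction hypothesis kept general in the target context, so
  that it can be used once at \<Delta> and once at its resurrection.\<close>

lemma wfc2_extend:
  assumes "wfc2 \<Delta>" "renames \<Delta> \<rho> \<Gamma>"
    and "\<And>\<Delta>. wfc2 \<Delta> \<Longrightarrow> renames \<Delta> \<rho> \<Gamma> \<Longrightarrow> \<Delta> \<tturnstile> ren \<rho> U \<^bold>: Sort s"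
  shows "wfc2 ((a, ren \<rho> U) # \<Delta>)"
  using assms(1) assms(3)[OF assms(1,2)] assms(3)[OF _ renames_to_resurrect[OF assms(2)]]
  by (auto simp: wfc2_def intro: wfc_extend)

lemma typ_ren_wfc2: "\<Gamma> \<tturnstile> t \<^bold>: T \<Longrightarrow> wfc2 \<Delta> \<Longrightarrow> renames \<Delta> \<rho> \<Gamma> \<Longrightarrow> \<Delta> \<tturnstile> ren \<rho> t \<^bold>: ren \<rho> T"
  and cnv_ren_wfc2: "\<Gamma> \<tturnstile> t \<^bold>= t' \<^bold>: T \<Longrightarrow> wfc2 \<Delta> \<Longrightarrow> renames \<Delta> \<rho> \<Gamma>
    \<Longrightarrow> \<Delta> \<tturnstile> ren \<rho> t \<^bold>= ren \<rho> t' \<^bold>: ren \<rho> T"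
proof (induction arbitrary: \<Delta> \<rho> and \<Delta> \<rho> rule: wfc_wty_cnv.inducts(2,3)[where ?P1.0="\<lambda>_. True"])
  case (typ_var \<Gamma> n T)
  then show ?case by (auto simp: renames_def wfc2_def intro: wfc_wty_cnv.typ_var)
next
  case (typ_lam \<Gamma> U s a T s' t)
  note U = typ_lam.IH(1)[OF typ_lam.prems, simplified]
  have wf: "wfc2 ((a, ren \<rho> U) # \<Delta>)"
    by (rule wfc2_extend[OF typ_lam.prems]) (use typ_lam.IH(1) in auto)
  show ?case
    using U
      typ_lam.IH(2,3)[OF wf renames_lift[OF typ_lam.prems(2)]]
    by (auto intro!: wfc_wty_cnv.typ_lam)
next
  case (typ_pi \<Gamma> U i a T j)
  note U = typ_pi.IH(1)[OF typ_pi.prems, simplified]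
  have wf: "wfc2 ((a, ren \<rho> U) # \<Delta>)"
    by (rule wfc2_extend[OF typ_pi.prems]) (use typ_pi.IH(1) in auto)
  show ?case
    using U
      typ_pi.IH(2)[OF wf renames_lift[OF typ_pi.prems(2)]]
    by (auto intro!: wfc_wty_cnv.typ_pi)
next
  case (typ_app \<Gamma> U s a T s' t u)
  note U = typ_app.IH(1)[OF typ_app.prems, simplified]
  have wf: "wfc2 ((a, ren \<rho> U) # \<Delta>)"
    by (rule wfc2_extend[OF typ_app.prems]) (use typ_app.IH(1) in auto)
  show ?case
    using U typ_app.IH(3)[OF typ_app.prems]
      typ_app.IH(2)[OF wf renames_lift[OF typ_app.prems(2)]]
      typ_app.IH(4)[OF wfc2_ctx_for[OF typ_app.prems(1)] renames_ctx_for[OF typ_app.prems(2)]]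
    by (auto simp: ren_inst intro!: wfc_wty_cnv.typ_app[where s=s and s'=s'])
next
  case (cnv_beta \<Gamma> U s a T s' t u)
  note U = cnv_beta.IH(1)[OF cnv_beta.prems, simplified]
  have wf: "wfc2 ((a, ren \<rho> U) # \<Delta>)"
    by (rule wfc2_extend[OF cnv_beta.prems]) (use cnv_beta.IH(1) in auto)
  show ?case
    using U
      cnv_beta.IH(2,3)[OF wf renames_lift[OF cnv_beta.prems(2)]]
      cnv_beta.IH(4)[OF wfc2_ctx_for[OF cnv_beta.prems(1)] renames_ctx_for[OF cnv_beta.prems(2)]]
    by (auto simp: ren_inst intro!: wfc_wty_cnv.cnv_beta[where s=s and s'=s'])
next
  case (cnv_eta \<Gamma> U s a T s' t)
  note U = cnv_eta.IH(1)[OF cnv_eta.prems, simplified]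
  have wf: "wfc2 ((a, ren \<rho> U) # \<Delta>)"
    by (rule wfc2_extend[OF cnv_eta.prems]) (use cnv_eta.IH(1) in auto)
  show ?case
    using U cnv_eta.IH(3)[OF cnv_eta.prems]
      cnv_eta.IH(2)[OF wf renames_lift[OF cnv_eta.prems(2)]]
    by (auto simp: ren_lift_Suc intro!: wfc_wty_cnv.cnv_eta)
next
  case (cnv_pi \<Gamma> U i U' a T T' j)
  note U = cnv_pi.IH(1)[OF cnv_pi.prems, simplified]
  have wf: "wfc2 ((a, ren \<rho> U) # \<Delta>)"
    by (rule wfc2_extend[OF cnv_pi.prems]) (use cnv_pi.IH(1) in auto)
  show ?case
    using U cnv_pi.IH(2)[OF cnv_pi.prems]
      cnv_pi.IH(3)[OF wf renames_lift[OF cnv_pi.prems(2)]]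
    by (auto intro!: wfc_wty_cnv.cnv_pi)
next
  case (cnv_lam \<Gamma> U s U' a T s' t t')
  note U = cnv_lam.IH(1)[OF cnv_lam.prems, simplified]
  have wf: "wfc2 ((a, ren \<rho> U) # \<Delta>)"
    by (rule wfc2_extend[OF cnv_lam.prems]) (use cnv_lam.IH(1) in auto)
  show ?case
    using U cnv_lam.IH(2)[OF cnv_lam.prems]
      cnv_lam.IH(3,4)[OF wf renames_lift[OF cnv_lam.prems(2)]]
    by (auto intro!: wfc_wty_cnv.cnv_lam)
next
  case (cnv_app \<Gamma> U s T s' t t' u u')
  note U = cnv_app.IH(1)[OF cnv_app.prems, simplified]
  have wf: "wfc2 ((Relevant, ren \<rho> U) # \<Delta>)"
    by (rule wfc2_extend[OF cnv_app.prems]) (use cnv_app.IH(1) in auto)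
  show ?case
    using U cnv_app.IH(3,4)[OF cnv_app.prems]
      cnv_app.IH(2)[OF wf renames_lift[OF cnv_app.prems(2)]]
    by (auto simp: ren_inst intro!: wfc_wty_cnv.cnv_app[where s=s and s'=s'])
next
  case (cnv_app_irr \<Gamma> U s T s' t t' u u')
  note U = cnv_app_irr.IH(1)[OF cnv_app_irr.prems, simplified]
  have wf: "wfc2 ((Irrelevant, ren \<rho> U) # \<Delta>)"
    by (rule wfc2_extend[OF cnv_app_irr.prems]) (use cnv_app_irr.IH(1) in auto)
  show ?case
    using U cnv_app_irr.IH(3)[OF cnv_app_irr.prems]
      cnv_app_irr.IH(2)[OF wf renames_lift[OF cnv_app_irr.prems(2)]]
      cnv_app_irr.IH(4,5)[OF wfc2_resurrect[OF cnv_app_irr.prems(1)] renames_resurrect[OF cnv_app_irr.prems(2)]]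
    by (auto simp: ren_inst intro!: wfc_wty_cnv.cnv_app_irr[where s=s and s'=s'])
next
  case (cnv_trans \<Gamma> t1 t2 T t3)
  then show ?case by (meson wfc_wty_cnv.cnv_trans)next
  case (typ_conv \<Gamma> t T T' s)
  show ?case using typ_conv.IH[OF typ_conv.prems] by (auto intro: wfc_wty_cnv.typ_conv)
next
  case (cnv_conv \<Gamma> t t' T T' s)
  show ?case using cnv_conv.IH[OF cnv_conv.prems] by (auto intro: wfc_wty_cnv.cnv_conv)
qed (auto simp: wfc2_def intro: wfc_wty_cnv.intros)

lemma wfc_resurrect: "\<tturnstile> \<Gamma> \<Longrightarrow> \<tturnstile> resurrect \<Gamma>"
proof (induction \<Gamma>)
  case (Cons X \<Gamma>)
  obtain a U where X: "X = (a, U)" by force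
  with Cons.prems obtain s where U: "\<tturnstile> \<Gamma>" "\<Gamma> \<tturnstile> U \<^bold>: Sort s" by (auto elim: wfc_ConsE)
  with Cons.IH have r: "\<tturnstile> resurrect \<Gamma>" by simp
  \<comment> \<open>The target satisfies \<open>wfc2\<close> because resurrection is
    idempotent.\<close>
  have "resurrect \<Gamma> \<tturnstile> ren id U \<^bold>: ren id (Sort s)"
    using U r by (intro typ_ren_wfc2) (auto simp: wfc2_def intro: renames_to_resurrect renames_id)
  then show ?case using X r by (auto simp: ren_id intro: wfc_extend)
qed (simp add: wfc_empty)

lemma wfc_ctx_for: "\<tturnstile> \<Gamma> \<Longrightarrow> \<tturnstile> ctx_for a \<Gamma>"
  by (cases a) (auto intro: wfc_resurrect)

lemma wfc2_iff: "wfc2 \<Gamma> \<longleftrightarrow> \<tturnstile> \<Gamma>"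
  by (auto simp: wfc2_def wfc_resurrect)

lemmas typ_ren = typ_ren_wfc2[unfolded wfc2_iff]
lemmas cnv_ren = cnv_ren_wfc2[unfolded wfc2_iff]

lemma typ_Suc: "\<Gamma> \<tturnstile> t \<^bold>: T \<Longrightarrow> \<tturnstile> X # \<Gamma> \<Longrightarrow> X # \<Gamma> \<tturnstile> ren Suc t \<^bold>: ren Suc T"
  by (rule typ_ren) (auto intro: renames_Suc)

lemma typ_resurrect: "\<Gamma> \<tturnstile> t \<^bold>: T \<Longrightarrow> resurrect \<Gamma> \<tturnstile> t \<^bold>: T"
  using typ_ren[of \<Gamma> t T "resurrect \<Gamma>" id]
  by (simp add: ren_id renames_to_resurrect renames_id wfc_resurrect typ_wfc)

lemma cnv_resurrect: "\<Gamma> \<tturnstile> t \<^bold>= t' \<^bold>: T \<Longrightarrow> resurrect \<Gamma> \<tturnstile> t \<^bold>= t' \<^bold>: T"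
  using cnv_ren[of \<Gamma> t t' T "resurrect \<Gamma>" id]
  by (simp add: ren_id renames_to_resurrect renames_id wfc_resurrect cnv_wfc)

lemma cnv_ctx_for: "\<Gamma> \<tturnstile> t \<^bold>= t' \<^bold>: T \<Longrightarrow> ctx_for a \<Gamma> \<tturnstile> t \<^bold>= t' \<^bold>: T"
  by (cases a) (auto intro: cnv_resurrect)

lemma typ_ctx_for_conv:
  "ctx_for a \<Gamma> \<tturnstile> t \<^bold>: T \<Longrightarrow> \<Gamma> \<tturnstile> T \<^bold>= T' \<^bold>: Sort s \<Longrightarrow> ctx_for a \<Gamma> \<tturnstile> t \<^bold>: T'"
  by (blast intro: typ_conv cnv_ctx_for)

lemma lookup_ctx_for: "lookup \<Gamma> n a T \<Longrightarrow> lookup (ctx_for a \<Gamma>) n Relevant T"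
  by (cases a) (auto intro: lookup_resurrectI)

lemma typ_var_ctx_for: "\<tturnstile> \<Gamma> \<Longrightarrow> lookup \<Gamma> n a T \<Longrightarrow> ctx_for a \<Gamma> \<tturnstile> Var n \<^bold>: T"
  by (simp add: typ_var lookup_ctx_for wfc_ctx_for)

text \<open>The image of an irrelevant variable has to be typed only after resurrection, exactly
  what \<open>typ_app\<close> demands of an irrelevant argument.\<close>

definition substs :: "ctx \<Rightarrow> (nat \<Rightarrow> exp) \<Rightarrow> ctx \<Rightarrow> bool" where
  "substs \<Delta> \<sigma> \<Gamma> \<longleftrightarrow> (\<forall>n a T. lookup \<Gamma> n a T \<longrightarrow> ctx_for a \<Delta> \<tturnstile> \<sigma> n \<^bold>: sub \<sigma> T)"

lemma substs_resurrect: "substs \<Delta> \<sigma> \<Gamma> \<Longrightarrow> substs (resurrect \<Delta>) \<sigma> (resurrect \<Gamma>)"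
  unfolding substs_def
  by (metis ann.exhaust ctx_for.simps lookup_resurrectD typ_resurrect)

lemma substs_ctx_for: "substs \<Delta> \<sigma> \<Gamma> \<Longrightarrow> substs (ctx_for a \<Delta>) \<sigma> (ctx_for a \<Gamma>)"
  by (cases a) (auto intro: substs_resurrect)

lemma ctx_for_Cons: "\<exists>b. ctx_for a ((b', U) # \<Delta>) = (b, U) # ctx_for a \<Delta>"
  by (cases a) auto

lemma typ_Suc_ctx_for:
  assumes "ctx_for a \<Delta> \<tturnstile> t \<^bold>: T" "\<tturnstile> (b, U) # \<Delta>"
  shows "ctx_for a ((b, U) # \<Delta>) \<tturnstile> ren Suc t \<^bold>: ren Suc T"
  using assms wfc_ctx_for[OF assms(2), of a] ctx_for_Cons[of a b U \<Delta>]
  by (metis typ_Suc)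

lemma substs_Cons:
  assumes "substs \<Delta> (\<sigma> \<circ> Suc) \<Gamma>" "ctx_for a \<Delta> \<tturnstile> \<sigma> 0 \<^bold>: sub (\<sigma> \<circ> Suc) U"
  shows "substs \<Delta> \<sigma> ((a, U) # \<Gamma>)"
  using assms by (auto simp: substs_def sub_ren elim!: lookup_ConsE)

lemma substs_weaken: "substs \<Delta> \<sigma> \<Gamma> \<Longrightarrow> \<tturnstile> (a, V) # \<Delta> \<Longrightarrow> substs ((a, V) # \<Delta>) (ren Suc \<circ> \<sigma>) \<Gamma>"
  unfolding substs_def using typ_Suc_ctx_for by (auto simp: ren_sub[symmetric])

lemma lift_sub_Suc [simp]: "lift_sub \<sigma> \<circ> Suc = ren Suc \<circ> \<sigma>"
  by auto

text \<open>The new binding may carry a type that is merely equal to the substituted one. This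
  covers two substitutions lifted over the same extended context and, with \<open>Var\<close> as the
  substitution, conversion of a type in a context.\<close>

lemma substs_lift_conv:
  assumes "substs \<Delta> \<sigma> \<Gamma>" "\<tturnstile> (a, V) # \<Delta>" "\<Delta> \<tturnstile> V \<^bold>= sub \<sigma> U \<^bold>: Sort s"
  shows "substs ((a, V) # \<Delta>) (lift_sub \<sigma>) ((a, U) # \<Gamma>)"
proof (rule substs_Cons)
  show "substs ((a, V) # \<Delta>) (lift_sub \<sigma> \<circ> Suc) \<Gamma>" using assms by (simp add: substs_weaken)
  have "(a, V) # \<Delta> \<tturnstile> ren Suc V \<^bold>= ren Suc (sub \<sigma> U) \<^bold>: ren Suc (Sort s)"
    using assms by (intro cnv_ren) (auto intro: renames_Suc)
  then show "ctx_for a ((a, V) # \<Delta>) \<tturnstile> lift_sub \<sigma> 0 \<^bold>: sub (lift_sub \<sigma> \<circ> Suc) U"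
    using typ_ctx_for_conv[OF typ_var_ctx_for[OF assms(2) lookup_0]] by (simp add: ren_sub)
qed

lemma substs_lift:
  assumes "substs \<Delta> \<sigma> \<Gamma>" "\<Delta> \<tturnstile> sub \<sigma> U \<^bold>: Sort s"
  shows "substs ((a, sub \<sigma> U) # \<Delta>) (lift_sub \<sigma>) ((a, U) # \<Gamma>)"
  using assms by (blast intro: substs_lift_conv wfc_extend typ_wfc cnv_refl)

lemma typ_sub: "\<Gamma> \<tturnstile> t \<^bold>: T \<Longrightarrow> \<tturnstile> \<Delta> \<Longrightarrow> substs \<Delta> \<sigma> \<Gamma> \<Longrightarrow> \<Delta> \<tturnstile> sub \<sigma> t \<^bold>: sub \<sigma> T"
  and cnv_sub: "\<Gamma> \<tturnstile> t \<^bold>= t' \<^bold>: T \<Longrightarrow> \<tturnstile> \<Delta> \<Longrightarrow> substs \<Delta> \<sigma> \<Gamma>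
    \<Longrightarrow> \<Delta> \<tturnstile> sub \<sigma> t \<^bold>= sub \<sigma> t' \<^bold>: sub \<sigma> T"
proof (induction arbitrary: \<Delta> \<sigma> and \<Delta> \<sigma> rule: wfc_wty_cnv.inducts(2,3)[where ?P1.0="\<lambda>_. True"])
  case (typ_var \<Gamma> n T)
  then show ?case by (fastforce simp: substs_def)
next
  case (typ_lam \<Gamma> U s a T s' t)
  note U = typ_lam.IH(1)[OF typ_lam.prems, simplified]
  have wf: "\<tturnstile> (a, sub \<sigma> U) # \<Delta>" by (rule wfc_extend[OF typ_lam.prems(1) U])
  show ?case
    using U
      typ_lam.IH(2,3)[OF wf substs_lift[OF typ_lam.prems(2) U]]
    by (auto intro!: wfc_wty_cnv.typ_lam)
next
  case (typ_pi \<Gamma> U i a T j)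
  note U = typ_pi.IH(1)[OF typ_pi.prems, simplified]
  have wf: "\<tturnstile> (a, sub \<sigma> U) # \<Delta>" by (rule wfc_extend[OF typ_pi.prems(1) U])
  show ?case
    using U
      typ_pi.IH(2)[OF wf substs_lift[OF typ_pi.prems(2) U]]
    by (auto intro!: wfc_wty_cnv.typ_pi)
next
  case (typ_app \<Gamma> U s a T s' t u)
  note U = typ_app.IH(1)[OF typ_app.prems, simplified]
  have wf: "\<tturnstile> (a, sub \<sigma> U) # \<Delta>" by (rule wfc_extend[OF typ_app.prems(1) U])
  show ?case
    using U typ_app.IH(3)[OF typ_app.prems]
      typ_app.IH(2)[OF wf substs_lift[OF typ_app.prems(2) U]]
      typ_app.IH(4)[OF wfc_ctx_for[OF typ_app.prems(1)] substs_ctx_for[OF typ_app.prems(2)]]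
    by (auto simp: sub_inst_lift intro!: wfc_wty_cnv.typ_app[where s=s and s'=s'])
next
  case (cnv_beta \<Gamma> U s a T s' t u)
  note U = cnv_beta.IH(1)[OF cnv_beta.prems, simplified]
  have wf: "\<tturnstile> (a, sub \<sigma> U) # \<Delta>" by (rule wfc_extend[OF cnv_beta.prems(1) U])
  show ?case
    using U
      cnv_beta.IH(2,3)[OF wf substs_lift[OF cnv_beta.prems(2) U]]
      cnv_beta.IH(4)[OF wfc_ctx_for[OF cnv_beta.prems(1)] substs_ctx_for[OF cnv_beta.prems(2)]]
    by (auto simp: sub_inst_lift intro!: wfc_wty_cnv.cnv_beta[where s=s and s'=s'])
next
  case (cnv_eta \<Gamma> U s a T s' t)
  note U = cnv_eta.IH(1)[OF cnv_eta.prems, simplified]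
  have wf: "\<tturnstile> (a, sub \<sigma> U) # \<Delta>" by (rule wfc_extend[OF cnv_eta.prems(1) U])
  show ?case
    using U cnv_eta.IH(3)[OF cnv_eta.prems]
      cnv_eta.IH(2)[OF wf substs_lift[OF cnv_eta.prems(2) U]]
    by (auto simp: sub_lift_Suc intro!: wfc_wty_cnv.cnv_eta)
next
  case (cnv_pi \<Gamma> U i U' a T T' j)
  note U = cnv_pi.IH(1)[OF cnv_pi.prems, simplified]
  have wf: "\<tturnstile> (a, sub \<sigma> U) # \<Delta>" by (rule wfc_extend[OF cnv_pi.prems(1) U])
  show ?case
    using U cnv_pi.IH(2)[OF cnv_pi.prems]
      cnv_pi.IH(3)[OF wf substs_lift[OF cnv_pi.prems(2) U]]
    by (auto intro!: wfc_wty_cnv.cnv_pi)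
next
  case (cnv_lam \<Gamma> U s U' a T s' t t')
  note U = cnv_lam.IH(1)[OF cnv_lam.prems, simplified]
  have wf: "\<tturnstile> (a, sub \<sigma> U) # \<Delta>" by (rule wfc_extend[OF cnv_lam.prems(1) U])
  show ?case
    using U cnv_lam.IH(2)[OF cnv_lam.prems]
      cnv_lam.IH(3,4)[OF wf substs_lift[OF cnv_lam.prems(2) U]]
    by (auto intro!: wfc_wty_cnv.cnv_lam)
next
  case (cnv_app \<Gamma> U s T s' t t' u u')
  note U = cnv_app.IH(1)[OF cnv_app.prems, simplified]
  have wf: "\<tturnstile> (Relevant, sub \<sigma> U) # \<Delta>" by (rule wfc_extend[OF cnv_app.prems(1) U])
  show ?case
    using U cnv_app.IH(3,4)[OF cnv_app.prems]
      cnv_app.IH(2)[OF wf substs_lift[OF cnv_app.prems(2) U]]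
    by (auto simp: sub_inst_lift intro!: wfc_wty_cnv.cnv_app[where s=s and s'=s'])
next
  case (cnv_app_irr \<Gamma> U s T s' t t' u u')
  note U = cnv_app_irr.IH(1)[OF cnv_app_irr.prems, simplified]
  have wf: "\<tturnstile> (Irrelevant, sub \<sigma> U) # \<Delta>" by (rule wfc_extend[OF cnv_app_irr.prems(1) U])
  show ?case
    using U cnv_app_irr.IH(3)[OF cnv_app_irr.prems]
      cnv_app_irr.IH(2)[OF wf substs_lift[OF cnv_app_irr.prems(2) U]]
      cnv_app_irr.IH(4,5)[OF wfc_resurrect[OF cnv_app_irr.prems(1)] substs_resurrect[OF cnv_app_irr.prems(2)]]
    by (auto simp: sub_inst_lift intro!: wfc_wty_cnv.cnv_app_irr[where s=s and s'=s'])
next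
  case (cnv_trans \<Gamma> t1 t2 T t3)
  then show ?case by (meson wfc_wty_cnv.cnv_trans)next
  case (typ_conv \<Gamma> t T T' s)
  show ?case using typ_conv.IH[OF typ_conv.prems] by (auto intro: wfc_wty_cnv.typ_conv)
next
  case (cnv_conv \<Gamma> t t' T T' s)
  show ?case using cnv_conv.IH[OF cnv_conv.prems] by (auto intro: wfc_wty_cnv.cnv_conv)
qed (auto intro: wfc_wty_cnv.intros)

section \<open>Instantiation and context conversion as special substitutions\<close>

lemma substs_Var: "\<tturnstile> \<Gamma> \<Longrightarrow> substs \<Gamma> Var \<Gamma>"
  by (auto simp: substs_def intro: typ_var_ctx_for)

lemma substs_scons:
  "substs \<Delta> \<sigma> \<Gamma> \<Longrightarrow> ctx_for a \<Delta> \<tturnstile> u \<^bold>: sub \<sigma> U \<Longrightarrow> substs \<Delta> (scons u \<sigma>) ((a, U) # \<Gamma>)"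
  by (rule substs_Cons) auto

lemma typ_inst: "(a, U) # \<Gamma> \<tturnstile> t \<^bold>: T \<Longrightarrow> ctx_for a \<Gamma> \<tturnstile> u \<^bold>: U \<Longrightarrow> \<Gamma> \<tturnstile> inst u t \<^bold>: inst u T"
  unfolding inst_scons
  by (frule typ_wfc) (auto elim!: wfc_ConsE intro!: typ_sub substs_scons substs_Var)

text \<open>Changing the type of the newest binding is substitution by the identity, since the new
  variable has the old type by conversion.\<close>

lemma substs_ctx_conv:
  assumes "\<Gamma> \<tturnstile> U \<^bold>= U' \<^bold>: Sort s" "\<Gamma> \<tturnstile> U' \<^bold>: Sort s'"
  shows "substs ((a, U') # \<Gamma>) Var ((a, U) # \<Gamma>)"
  using substs_lift_conv[OF substs_Var, of \<Gamma> a U' U s] assms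
  by (auto intro: wfc_extend typ_wfc cnv_sym)

lemma typ_ctx_conv:
  "(a, U) # \<Gamma> \<tturnstile> t \<^bold>: T \<Longrightarrow> \<Gamma> \<tturnstile> U \<^bold>= U' \<^bold>: Sort s \<Longrightarrow> \<Gamma> \<tturnstile> U' \<^bold>: Sort s' \<Longrightarrow> (a, U') # \<Gamma> \<tturnstile> t \<^bold>: T"
  using typ_sub[of "(a, U) # \<Gamma>" t T "(a, U') # \<Gamma>" Var] substs_ctx_conv
  by (auto intro: wfc_extend typ_wfc)

lemma cnv_ctx_conv:
  "(a, U) # \<Gamma> \<tturnstile> t \<^bold>= t' \<^bold>: T \<Longrightarrow> \<Gamma> \<tturnstile> U \<^bold>= U' \<^bold>: Sort s \<Longrightarrow> \<Gamma> \<tturnstile> U' \<^bold>: Sort s'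
    \<Longrightarrow> (a, U') # \<Gamma> \<tturnstile> t \<^bold>= t' \<^bold>: T"
  using cnv_sub[of "(a, U) # \<Gamma>" t t' T "(a, U') # \<Gamma>" Var] substs_ctx_conv
  by (auto intro: wfc_extend typ_wfc)


section \<open>Functionality and validity\<close>

text \<open>Irrelevant bindings are only required to have well-typed images on both sides, in
  accordance with \<open>cnv_app_irr\<close>, which accepts any two typed arguments.\<close>

definition substs_eq :: "ctx \<Rightarrow> (nat \<Rightarrow> exp) \<Rightarrow> (nat \<Rightarrow> exp) \<Rightarrow> ctx \<Rightarrow> bool" where
  "substs_eq \<Delta> \<sigma> \<sigma>' \<Gamma> \<longleftrightarrow> substs \<Delta> \<sigma> \<Gamma> \<and> substs \<Delta> \<sigma>' \<Gamma> \<and>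
     (\<forall>n T. lookup \<Gamma> n Relevant T \<longrightarrow> \<Delta> \<tturnstile> \<sigma> n \<^bold>= \<sigma>' n \<^bold>: sub \<sigma> T)"

lemma substs_eq_lift:
  assumes "substs_eq \<Delta> \<sigma> \<sigma>' \<Gamma>" "\<Delta> \<tturnstile> sub \<sigma> U \<^bold>: Sort s" "\<Delta> \<tturnstile> sub \<sigma> U \<^bold>= sub \<sigma>' U \<^bold>: Sort s"
  shows "substs_eq ((a, sub \<sigma> U) # \<Delta>) (lift_sub \<sigma>) (lift_sub \<sigma>') ((a, U) # \<Gamma>)"
proof -
  have wf: "\<tturnstile> (a, sub \<sigma> U) # \<Delta>" using assms by (auto intro: wfc_extend typ_wfc)
  have "(a, sub \<sigma> U) # \<Delta> \<tturnstile> lift_sub \<sigma> n \<^bold>= lift_sub \<sigma>' n \<^bold>: sub (lift_sub \<sigma>) T"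
    if "lookup ((a, U) # \<Gamma>) n Relevant T" for n T
  proof -
    from that consider "n = 0" "a = Relevant" "T = ren Suc U"
      | m T' where "n = Suc m" "T = ren Suc T'" "lookup \<Gamma> m Relevant T'"
      by (auto elim!: lookup_ConsE)
    then show ?thesis
    proof cases
      case 1
      then show ?thesis using wf lookup_0[of a "sub \<sigma> U" \<Delta>]
        by (auto simp: sub_lift_Suc intro!: cnv_refl typ_var)
    next
      case (2 m T')
      then have "\<Delta> \<tturnstile> \<sigma> m \<^bold>= \<sigma>' m \<^bold>: sub \<sigma> T'" using assms by (auto simp: substs_eq_def)
      then show ?thesis using 2 wf by (auto simp: sub_lift_Suc intro!: cnv_ren renames_Suc)
    qed
  qed
  then show ?thesis using assms wf
    by (auto simp: substs_eq_def intro!: substs_lift substs_lift_conv)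
qed

lemma substs_eq_scons:
  assumes "substs_eq \<Delta> \<sigma> \<sigma>' \<Gamma>" "ctx_for a \<Delta> \<tturnstile> u \<^bold>: sub \<sigma> U" "ctx_for a \<Delta> \<tturnstile> u' \<^bold>: sub \<sigma>' U"
    and "a = Relevant \<Longrightarrow> \<Delta> \<tturnstile> u \<^bold>= u' \<^bold>: sub \<sigma> U"
  shows "substs_eq \<Delta> (scons u \<sigma>) (scons u' \<sigma>') ((a, U) # \<Gamma>)"
  using assms by (auto simp: substs_eq_def intro!: substs_scons elim!: lookup_ConsE)

lemma substs_eq_refl: "substs \<Delta> \<sigma> \<Gamma> \<Longrightarrow> substs_eq \<Delta> \<sigma> \<sigma> \<Gamma>"
  by (fastforce simp: substs_eq_def substs_def intro: cnv_refl)

text \<open>Restricted to typing because validity in the application cases depends on it. Once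
  validity is known, \<open>cnv_functional\<close> extends it to equations by first substituting in
  the equation and then changing the substitution in its right side.\<close>

lemma typ_functional:
  "\<Gamma> \<tturnstile> t \<^bold>: T \<Longrightarrow> \<tturnstile> \<Delta> \<Longrightarrow> substs_eq \<Delta> \<sigma> \<sigma>' \<Gamma> \<Longrightarrow> \<Delta> \<tturnstile> sub \<sigma> t \<^bold>= sub \<sigma>' t \<^bold>: sub \<sigma> T"
proof (induction arbitrary: \<Delta> \<sigma> \<sigma>' rule: wfc_wty_cnv.inducts(2)[where ?P1.0="\<lambda>_. True" and ?P3.0="\<lambda>_ _ _ _. True"])
  case (typ_pi \<Gamma> U i a T j)
  have s: "substs \<Delta> \<sigma> \<Gamma>" using typ_pi by (simp add: substs_eq_def)
  note U = typ_sub[OF typ_pi.hyps(1) typ_pi.prems(1) s, simplified]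
  note Ue = typ_pi.IH(1)[OF typ_pi.prems, simplified]
  then show ?case using U typ_pi.IH(2)[OF _ substs_eq_lift[OF typ_pi.prems(2) U Ue]] typ_pi.prems
    by (auto intro!: cnv_pi wfc_extend)
next
  case (typ_var \<Gamma> n T)
  then show ?case by (auto simp: substs_eq_def)
next
  case (typ_lam \<Gamma> U s a T s' t)
  have s: "substs \<Delta> \<sigma> \<Gamma>" using typ_lam by (simp add: substs_eq_def)
  note U = typ_sub[OF typ_lam.hyps(1) typ_lam.prems(1) s, simplified]
  note Ue = typ_lam.IH(1)[OF typ_lam.prems, simplified]
  have "\<tturnstile> (a, sub \<sigma> U) # \<Delta>" using U typ_lam.prems by (auto intro: wfc_extend)
  then show ?case using U Ue typ_lam.IH(3)[OF _ substs_eq_lift[OF typ_lam.prems(2) U Ue]]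
      typ_sub[OF typ_lam.hyps(2) _ substs_lift[OF s U]]
    by (auto intro!: cnv_lam)
next
  case (typ_app \<Gamma> U s a T s' t u)
  have s: "substs \<Delta> \<sigma> \<Gamma>" "substs \<Delta> \<sigma>' \<Gamma>" using typ_app by (simp_all add: substs_eq_def)
  note U = typ_sub[OF typ_app.hyps(1) typ_app.prems(1) s(1), simplified]
  note Ue = typ_app.IH(1)[OF typ_app.prems, simplified]
  have wf: "\<tturnstile> (a, sub \<sigma> U) # \<Delta>" using U typ_app.prems by (auto intro: wfc_extend)
  have T: "(a, sub \<sigma> U) # \<Delta> \<tturnstile> sub (lift_sub \<sigma>) T \<^bold>: Sort s'"
    using typ_sub[OF typ_app.hyps(2) wf substs_lift[OF s(1) U]] by simp
  note t = typ_app.IH(3)[OF typ_app.prems, simplified]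
  show ?case
  proof (cases a)
    case Relevant
    have "\<Delta> \<tturnstile> sub \<sigma> u \<^bold>= sub \<sigma>' u \<^bold>: sub \<sigma> U" using typ_app.IH(4) typ_app.prems Relevant by simp
    then show ?thesis using U T t Relevant by (auto simp: sub_inst_lift intro: cnv_app)
  next
    case Irrelevant
    have "resurrect \<Delta> \<tturnstile> sub \<sigma> u \<^bold>: sub \<sigma> U" "resurrect \<Delta> \<tturnstile> sub \<sigma>' u \<^bold>: sub \<sigma>' U"
      using typ_app.hyps(4) typ_app.prems Irrelevant s
      by (auto intro!: typ_sub wfc_resurrect substs_resurrect)
    \<comment> \<open>\<open>cnv_app_irr\<close> takes both arguments at the domain under \<sigma>,
      while the second one is typed at the domain under \<sigma>'.\<close>
    moreover have "resurrect \<Delta> \<tturnstile> sub \<sigma>' U \<^bold>= sub \<sigma> U \<^bold>: Sort s"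
      using Ue by (auto intro: cnv_sym cnv_resurrect)
    ultimately show ?thesis using U T t Irrelevant
      by (auto simp: sub_inst_lift intro: cnv_app_irr typ_conv)
  qed
next
  case (typ_conv \<Gamma> t T T' s)
  then have "\<Delta> \<tturnstile> sub \<sigma> T \<^bold>= sub \<sigma> T' \<^bold>: sub \<sigma> (Sort s)"
    by (intro cnv_sub) (auto simp: substs_eq_def)
  then show ?case using typ_conv.IH(1) typ_conv.prems by (auto intro: cnv_conv)
qed (auto intro: cnv_refl typ_sort)

lemma lookup_typ: "lookup \<Gamma> n a T \<Longrightarrow> \<tturnstile> \<Gamma> \<Longrightarrow> \<exists>s. \<Gamma> \<tturnstile> T \<^bold>: Sort s"
proof (induction rule: lookup.induct)
  case (lookup_0 a U \<Gamma>)
  then show ?case by (metis ren.simps(1) typ_Suc wfc_ConsE)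
next
  case (lookup_Suc \<Gamma> n a T X)
  then show ?case by (metis ren.simps(1) typ_Suc wfc_ConsE surj_pair)
qed

lemma inst_functional:
  assumes "(a, U) # \<Gamma> \<tturnstile> T \<^bold>: Sort s" "ctx_for a \<Gamma> \<tturnstile> u \<^bold>: U" "ctx_for a \<Gamma> \<tturnstile> u' \<^bold>: U"
    and "a = Relevant \<Longrightarrow> \<Gamma> \<tturnstile> u \<^bold>= u' \<^bold>: U"
  shows "\<Gamma> \<tturnstile> inst u T \<^bold>= inst u' T \<^bold>: Sort s"
proof -
  have wf: "\<tturnstile> \<Gamma>" using typ_wfc[OF assms(1)] by (auto elim: wfc_ConsE)
  have "substs_eq \<Gamma> (scons u Var) (scons u' Var) ((a, U) # \<Gamma>)"
    using assms wf by (intro substs_eq_scons substs_eq_refl substs_Var) auto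
  then show ?thesis using typ_functional[OF assms(1) wf] by (auto simp: inst_scons)
qed

lemma typ_eta_body:
  assumes "\<Gamma> \<tturnstile> U \<^bold>: Sort s" "(a, U) # \<Gamma> \<tturnstile> T \<^bold>: Sort s'" "\<Gamma> \<tturnstile> t \<^bold>: Pi a s s' U T"
  shows "(a, U) # \<Gamma> \<tturnstile> App a (ren Suc t) (Var 0) \<^bold>: T"
proof -
  have wf: "\<tturnstile> (a, U) # \<Gamma>" using assms by (auto intro: typ_wfc)
  have t: "(a, U) # \<Gamma> \<tturnstile> ren Suc t \<^bold>: Pi a s s' (ren Suc U) (ren (lift_ren Suc) T)"
    using typ_Suc[OF assms(3) wf] by simp
  have U: "(a, U) # \<Gamma> \<tturnstile> ren Suc U \<^bold>: Sort s" using typ_Suc[OF assms(1) wf] by simp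
  have "(a, ren Suc U) # (a, U) # \<Gamma> \<tturnstile> ren (lift_ren Suc) T \<^bold>: ren (lift_ren Suc) (Sort s')"
    by (rule typ_ren[OF assms(2) wfc_extend[OF wf U] renames_lift[OF renames_Suc]])
  then show ?thesis
    using typ_app[OF U _ t typ_var_ctx_for[OF wf lookup_0]] by simp
qed

text \<open>The work lies in the right sides of the congruence rules: their types mention the second
  domain or the second argument. Context conversion handles the domain and
  \<open>inst_functional\<close> the argument.\<close>

lemma typ_valid: "\<Gamma> \<tturnstile> t \<^bold>: T \<Longrightarrow> \<exists>s. \<Gamma> \<tturnstile> T \<^bold>: Sort s"
  and cnv_valid: "\<Gamma> \<tturnstile> t \<^bold>= t' \<^bold>: T \<Longrightarrow> \<Gamma> \<tturnstile> t \<^bold>: T \<and> \<Gamma> \<tturnstile> t' \<^bold>: T \<and> (\<exists>s. \<Gamma> \<tturnstile> T \<^bold>: Sort s)"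
proof (induction rule: wfc_wty_cnv.inducts(2,3)[where ?P1.0="\<lambda>_. True"])
  case (typ_sort \<Gamma> i)
  then show ?case by (blast intro: wfc_wty_cnv.typ_sort)
next
  case (typ_pi \<Gamma> U i a T j)
  then show ?case by (blast intro: wfc_wty_cnv.typ_sort typ_wfc)
next
  case (typ_var \<Gamma> n T)
  then show ?case by (blast intro: lookup_typ)
next
  case (typ_lam \<Gamma> U s a T s' t)
  then show ?case by (metis sort.exhaust wfc_wty_cnv.typ_pi)
next
  case (typ_app \<Gamma> U s a T s' t u)
  then show ?case using typ_inst[of a U \<Gamma> T "Sort s'" u] by (auto simp: inst_scons)
next
  case (typ_conv \<Gamma> t T T' s)
  then show ?case by blast
next
  case (cnv_beta \<Gamma> U s a T s' t u)
  then show ?case using typ_inst[of a U \<Gamma> T "Sort s'" u] typ_inst[of a U \<Gamma> t T u]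
    by (auto simp: inst_scons intro!: wfc_wty_cnv.typ_app[unfolded inst_scons] wfc_wty_cnv.typ_lam)
next
  case (cnv_eta \<Gamma> U s a T s' t)
  then show ?case by (auto intro!: wfc_wty_cnv.typ_lam typ_eta_body)
next
  case (cnv_pi \<Gamma> U i U' a T T' j)
  then have "(a, U') # \<Gamma> \<tturnstile> T' \<^bold>: Sort (Set j)" by (blast intro: typ_ctx_conv)
  with cnv_pi show ?case
    by (meson wfc_wty_cnv.typ_pi wfc_wty_cnv.typ_sort typ_wfc)
next
  case (cnv_lam \<Gamma> U s U' a T s' t t')
  obtain i j where s: "s = Set i" "s' = Set j" by (metis sort.exhaust)
  have T: "(a, U') # \<Gamma> \<tturnstile> T \<^bold>: Sort s'" and t': "(a, U') # \<Gamma> \<tturnstile> t' \<^bold>: T"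
    using cnv_lam by (blast intro: typ_ctx_conv)+
  then have "\<Gamma> \<tturnstile> Lam a U' t' \<^bold>: Pi a s s' U' T" using cnv_lam by (blast intro: wfc_wty_cnv.typ_lam)
  moreover have "\<Gamma> \<tturnstile> Pi a s s' U' T \<^bold>= Pi a s s' U T \<^bold>: Sort (Set (max i j))"
    using cnv_lam unfolding s by (blast intro: cnv_sym wfc_wty_cnv.cnv_pi cnv_refl)
  moreover have "\<Gamma> \<tturnstile> Lam a U t \<^bold>: Pi a s s' U T" using cnv_lam by (blast intro: wfc_wty_cnv.typ_lam)
  moreover have "\<Gamma> \<tturnstile> Pi a s s' U T \<^bold>: Sort (Set (max i j))"
    using cnv_lam s by (auto intro: wfc_wty_cnv.typ_pi)
  ultimately show ?case by (blast intro: wfc_wty_cnv.typ_conv)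
next
  case (cnv_app \<Gamma> U s T s' t t' u u')
  then have "\<Gamma> \<tturnstile> inst u' T \<^bold>= inst u T \<^bold>: Sort s'"
    by (intro inst_functional) (auto intro: cnv_sym)
  moreover have "\<Gamma> \<tturnstile> App Relevant t u \<^bold>: inst u T" "\<Gamma> \<tturnstile> App Relevant t' u' \<^bold>: inst u' T"
    using cnv_app by (auto intro!: wfc_wty_cnv.typ_app[where s=s and s'=s'])
  moreover have "\<Gamma> \<tturnstile> inst u T \<^bold>: Sort s'"
    using typ_inst[of Relevant U \<Gamma> T "Sort s'" u] cnv_app by (auto simp: inst_scons)
  ultimately show ?case by (blast intro: wfc_wty_cnv.typ_conv)
next
  case (cnv_app_irr \<Gamma> U s T s' t t' u u')
  then have "\<Gamma> \<tturnstile> inst u' T \<^bold>= inst u T \<^bold>: Sort s'"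
    by (intro inst_functional) (auto intro: cnv_sym)
  moreover have "\<Gamma> \<tturnstile> App Irrelevant t u \<^bold>: inst u T" "\<Gamma> \<tturnstile> App Irrelevant t' u' \<^bold>: inst u' T"
    using cnv_app_irr by (auto intro!: wfc_wty_cnv.typ_app[where s=s and s'=s'])
  moreover have "\<Gamma> \<tturnstile> inst u T \<^bold>: Sort s'"
    using typ_inst[of Irrelevant U \<Gamma> T "Sort s'" u] cnv_app_irr by (auto simp: inst_scons)
  ultimately show ?case by (blast intro: wfc_wty_cnv.typ_conv)
next
  case (cnv_conv \<Gamma> t t' T T' s)
  then show ?case by (blast intro: wfc_wty_cnv.typ_conv)
qed auto

lemma cnv_functional:
  assumes "\<Gamma> \<tturnstile> t \<^bold>= t' \<^bold>: T" "\<tturnstile> \<Delta>" "substs_eq \<Delta> \<sigma> \<sigma>' \<Gamma>"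
  shows "\<Delta> \<tturnstile> sub \<sigma> t \<^bold>= sub \<sigma>' t' \<^bold>: sub \<sigma> T"
proof -
  have "\<Delta> \<tturnstile> sub \<sigma> t \<^bold>= sub \<sigma> t' \<^bold>: sub \<sigma> T"
    using assms by (auto intro: cnv_sub simp: substs_eq_def)
  moreover have "\<Delta> \<tturnstile> sub \<sigma> t' \<^bold>= sub \<sigma>' t' \<^bold>: sub \<sigma> T"
    using assms by (auto intro: typ_functional dest: cnv_valid)
  ultimately show ?thesis by (rule cnv_trans)
qed

text \<open>The sorts stored in \<open>Pi\<close> are those of the formation rule, so inversion
  gives them exactly, and the conversion rule passes the conclusion on unchanged.\<close>

lemma typ_pi_inv:
  "\<Gamma> \<tturnstile> Pi a s s' U T \<^bold>: X \<Longrightarrow> \<Gamma> \<tturnstile> U \<^bold>: Sort s \<and> (a, U) # \<Gamma> \<tturnstile> T \<^bold>: Sort s'"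
  by (induction \<Gamma> "Pi a s s' U T" X rule: wfc_wty_cnv.inducts(2)[where ?P1.0="\<lambda>_. True" and ?P3.0="\<lambda>_ _ _ _. True"])
    auto

lemma typ_is_pi_inv:
  "\<Gamma> \<tturnstile> t \<^bold>: Pi a s s' U T \<Longrightarrow> \<Gamma> \<tturnstile> U \<^bold>: Sort s \<and> (a, U) # \<Gamma> \<tturnstile> T \<^bold>: Sort s'"
  by (blast dest: typ_valid typ_pi_inv)

text \<open>The premises that the original rules lack are recovered from validity and inversion,
  both already proved for the redundant system.\<close>

lemma wf_ctx_imp: "\<turnstile> \<Gamma> \<Longrightarrow> \<tturnstile> \<Gamma>"
  and has_type_imp: "\<Gamma> \<turnstile> t \<^bold>: T \<Longrightarrow> \<Gamma> \<tturnstile> t \<^bold>: T"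
  and eq_tm_imp: "\<Gamma> \<turnstile> t \<^bold>= t' \<^bold>: T \<Longrightarrow> \<Gamma> \<tturnstile> t \<^bold>= t' \<^bold>: T"
proof (induction rule: wf_ctx_has_type_eq_tm.inducts)
  case (ty_var \<Gamma> n U)
  then show ?case by (auto intro!: typ_var simp: lookup_nth)
next
  case (ty_lam a U \<Gamma> t T s s' s'')
  then show ?case by (blast intro: typ_lam dest: typ_pi_inv)
next
  case (ty_app \<Gamma> t a s s' U T u)
  then show ?case by (blast intro: typ_app dest: typ_is_pi_inv)
next
  case (eq_beta a U \<Gamma> t T u)
  then obtain s s' where "(a, U) # \<Gamma> \<tturnstile> T \<^bold>: Sort s'" "\<Gamma> \<tturnstile> U \<^bold>: Sort s"
    by (meson typ_valid typ_wfc wfc_ConsE)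
  with eq_beta show ?case by (blast intro: cnv_beta)
next
  case (eq_eta \<Gamma> t a s s' U T)
  then show ?case by (blast intro: cnv_eta dest: typ_is_pi_inv)
next
  case (eq_lam \<Gamma> U U' s1 a T s2 t t')
  then show ?case by (blast intro: cnv_lam dest: cnv_valid)
next
  case (eq_pi \<Gamma> U U' s1 a T T' s2 s3)
  then show ?case by (auto simp: Rule_def intro!: cnv_pi dest: cnv_valid)
next
  case (eq_app \<Gamma> t t' s s' U T u u')
  then show ?case by (blast intro: cnv_app dest: cnv_valid typ_is_pi_inv)
next
  case (eq_app_irr \<Gamma> t t' s s' U T u u')
  then show ?case by (blast intro: cnv_app_irr dest: cnv_valid typ_is_pi_inv)
next
  case (eq_trans \<Gamma> t1 t2 T t3)
  then show ?case by (blast intro: cnv_trans)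
qed (auto simp: Axiom_def Rule_def intro: wfc_wty_cnv.intros)

lemma wfc_imp: "\<tturnstile> \<Gamma> \<Longrightarrow> \<turnstile> \<Gamma>"
  and typ_imp: "\<Gamma> \<tturnstile> t \<^bold>: T \<Longrightarrow> \<Gamma> \<turnstile> t \<^bold>: T"
  and cnv_imp: "\<Gamma> \<tturnstile> t \<^bold>= t' \<^bold>: T \<Longrightarrow> \<Gamma> \<turnstile> t \<^bold>= t' \<^bold>: T"
proof (induction rule: wfc_wty_cnv.inducts)
  case (typ_var \<Gamma> n T)
  then show ?case using ty_var[of \<Gamma> n] by (auto simp: lookup_nth)
next
  case (typ_lam \<Gamma> U s a T s' t)
  obtain i j where "s = Set i" "s' = Set j" by (metis sort.exhaust)
  with typ_lam show ?case
    by (auto intro!: ty_lam ty_pi[where ?s3.0="Set (max i j)"] simp: Rule_def)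
next
  case (typ_pi \<Gamma> U i a T j)
  then show ?case by (auto intro!: ty_pi simp: Rule_def)
next
  case (cnv_pi \<Gamma> U i U' a T T' j)
  then show ?case by (auto intro!: eq_pi simp: Rule_def)
next
  case (cnv_trans \<Gamma> t1 t2 T t3)
  then show ?case by (blast intro: eq_trans)
qed (auto simp: Axiom_def intro: wf_ctx_has_type_eq_tm.intros)


section \<open>Weak head reduction and chains of type equalities\<close>

text \<open>Eta has no reduction rule: the relation compares functions by applying them, and this
  validates eta.\<close>

inductive step :: "exp \<Rightarrow> exp \<Rightarrow> bool" where
  step_beta: "step (App a (Lam a U t) u) (inst u t)"
| step_app: "step t t' \<Longrightarrow> step (App a t u) (App a t' u)"

inductive_cases step_AppE: "step (App a t u) v"

lemma not_step [simp]:
  "\<not> step (Lam a U t) v" "\<not> step (Sort s) v" "\<not> step (Pi a s s' U T) v" "\<not> step (Var n) v"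
  by (auto elim: step.cases)

inductive neutral :: "exp \<Rightarrow> bool" where
  neutral_var: "neutral (Var n)"
| neutral_app: "neutral t \<Longrightarrow> neutral (App a t u)"

lemma not_neutral [simp]:
  "\<not> neutral (Sort s)" "\<not> neutral (Pi a s s' U T)" "\<not> neutral (Lam a U t)"
  by (auto elim: neutral.cases)

lemma step_det: "step t u \<Longrightarrow> step t v \<Longrightarrow> u = v"
proof (induction arbitrary: v rule: step.induct)
  case (step_beta a U t u)
  from step_beta.prems show ?case by (rule step_AppE) simp_all
next
  case (step_app t t' a u)
  from step_app.prems show ?case
    by (rule step_AppE) (use step_app in auto)
qed

lemma neutral_step: "neutral t \<Longrightarrow> \<not> step t u"
proof (induction arbitrary: u rule: neutral.induct)
  case (neutral_app t a w)
  have False if "step (App a t w) u"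
    using that by (rule step_AppE) (use neutral_app in auto)
  then show ?case by blast
qed simp

text \<open>Only types are brought to this form, hence there is no clause for
  \<open>Lam\<close>.\<close>

definition whnf :: "exp \<Rightarrow> bool" where
  "whnf t \<longleftrightarrow> (\<exists>s. t = Sort s) \<or> (\<exists>a s s' U T. t = Pi a s s' U T) \<or> neutral t"

lemma whnf_simps [simp]: "whnf (Sort s)" "whnf (Pi a s s' U T)" "neutral t \<Longrightarrow> whnf t"
  by (auto simp: whnf_def)

lemma whnf_step: "whnf t \<Longrightarrow> \<not> step t u"
  by (auto simp: whnf_def neutral_step)

lemma whnf_unique:
  assumes "step\<^sup>*\<^sup>* t u" "step\<^sup>*\<^sup>* t v" "whnf u" "whnf v"
  shows "u = v"
  using assms
proof (induction arbitrary: v rule: converse_rtranclp_induct)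
  case base
  then show ?case by (metis converse_rtranclpE whnf_step)
next
  case (step y z)
  from step.prems(1) show ?case
  proof (cases rule: converse_rtranclpE)
    case base
    then show ?thesis using step whnf_step by blast
  next
    case (step z')
    then show ?thesis using step.IH step.prems \<open>step y z\<close> step_det by blast
  qed
qed

text \<open>
  Transitivity of equality needs both equations at the same sort, and uniqueness of sorts is not
  available yet. Hence the transitive closure over all sorts.
\<close>

definition teq :: "ctx \<Rightarrow> exp \<Rightarrow> exp \<Rightarrow> bool" where
  "teq \<Gamma> = (\<lambda>A B. \<exists>s. \<Gamma> \<tturnstile> A \<^bold>= B \<^bold>: Sort s)\<^sup>+\<^sup>+"

lemma teqI: "\<Gamma> \<tturnstile> A \<^bold>= B \<^bold>: Sort s \<Longrightarrow> teq \<Gamma> A B"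
  unfolding teq_def by blast

lemma teq_refl: "\<Gamma> \<tturnstile> A \<^bold>: Sort s \<Longrightarrow> teq \<Gamma> A A"
  by (blast intro: teqI cnv_refl)

lemma teq_trans [trans]: "teq \<Gamma> A B \<Longrightarrow> teq \<Gamma> B C \<Longrightarrow> teq \<Gamma> A C"
  unfolding teq_def by (rule tranclp_trans)

lemma teq_induct [consumes 1, case_names base step]:
  assumes "teq \<Gamma> A B" "\<And>B s. \<Gamma> \<tturnstile> A \<^bold>= B \<^bold>: Sort s \<Longrightarrow> Q B"
    "\<And>B C s. teq \<Gamma> A B \<Longrightarrow> \<Gamma> \<tturnstile> B \<^bold>= C \<^bold>: Sort s \<Longrightarrow> Q B \<Longrightarrow> Q C"
  shows "Q B"
  using assms(1)[unfolded teq_def]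
  by (induction rule: tranclp_induct) (use assms(2,3) in \<open>auto simp: teq_def\<close>)

lemma teq_sym: "teq \<Gamma> A B \<Longrightarrow> teq \<Gamma> B A"
  by (induction rule: teq_induct) (meson teqI teq_trans cnv_sym)+

lemma teq_typ: "teq \<Gamma> A B \<Longrightarrow> (\<exists>s. \<Gamma> \<tturnstile> A \<^bold>: Sort s) \<and> (\<exists>s. \<Gamma> \<tturnstile> B \<^bold>: Sort s)"
  by (induction rule: teq_induct) (blast dest: cnv_valid)+

lemma typ_teq: "\<Gamma> \<tturnstile> t \<^bold>: A \<Longrightarrow> teq \<Gamma> A B \<Longrightarrow> \<Gamma> \<tturnstile> t \<^bold>: B"
  by (rotate_tac, induction rule: teq_induct) (blast intro: typ_conv)+

lemma cnv_teq: "\<Gamma> \<tturnstile> t \<^bold>= t' \<^bold>: A \<Longrightarrow> teq \<Gamma> A B \<Longrightarrow> \<Gamma> \<tturnstile> t \<^bold>= t' \<^bold>: B"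
  by (rotate_tac, induction rule: teq_induct) (blast intro: cnv_conv)+

lemma teq_ctx_for: "teq \<Gamma> A B \<Longrightarrow> teq (ctx_for a \<Gamma>) A B"
  by (induction rule: teq_induct) (meson teqI teq_trans cnv_ctx_for)+

lemma teq_resurrect: "teq \<Gamma> A B \<Longrightarrow> teq (resurrect \<Gamma>) A B"
  using teq_ctx_for[of \<Gamma> A B Irrelevant] by simp

lemma teq_ctx_conv:
  assumes "teq \<Gamma> U U'" "teq ((a, U) # \<Gamma>) A B"
  shows "teq ((a, U') # \<Gamma>) A B"
proof -
  have *: "(a, U) # \<Gamma> \<tturnstile> A \<^bold>= B \<^bold>: Sort s \<Longrightarrow> (a, U') # \<Gamma> \<tturnstile> A \<^bold>= B \<^bold>: Sort s" for A B s
    using assms(1) by (induction rule: teq_induct) (meson cnv_ctx_conv cnv_valid)+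
  from assms(2) show ?thesis
    by (induction rule: teq_induct) (meson * teqI teq_trans)+
qed

lemma teq_functional:
  assumes "teq \<Gamma> A B" "\<tturnstile> \<Delta>" "substs_eq \<Delta> \<sigma> \<sigma>' \<Gamma>"
  shows "teq \<Delta> (sub \<sigma> A) (sub \<sigma>' B)"
  using assms(1)
proof (induction rule: teq_induct)
  case (base B s)
  then show ?case using cnv_functional[OF base assms(2,3)] by (auto intro: teqI)
next
  case (step B C s)
  \<comment> \<open>The change from \<sigma> to \<sigma>' happens in the first link of the chain;
    all later links are taken at \<sigma>' alone.\<close>
  have "substs_eq \<Delta> \<sigma>' \<sigma>' \<Gamma>" using assms(3) by (auto simp: substs_eq_def dest: substs_eq_refl)
  then have "\<Delta> \<tturnstile> sub \<sigma>' B \<^bold>= sub \<sigma>' C \<^bold>: Sort s"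
    using cnv_functional[OF step.hyps(2) assms(2)] by auto
  then show ?case using step.IH by (meson teqI teq_trans)
qed

lemma teq_inst:
  assumes "teq ((a, U) # \<Gamma>) T T'" "ctx_for a \<Gamma> \<tturnstile> u \<^bold>: U"
  shows "teq \<Gamma> (inst u T) (inst u T')"
proof -
  have wf: "\<tturnstile> \<Gamma>" using teq_typ[OF assms(1)] by (auto dest!: typ_wfc elim: wfc_ConsE)
  then have "substs_eq \<Gamma> (scons u Var) (scons u Var) ((a, U) # \<Gamma>)"
    using assms by (intro substs_eq_refl substs_scons substs_Var) auto
  then show ?thesis unfolding inst_scons by (rule teq_functional[OF assms(1) wf])
qed

text \<open>That reduction of a typed term is an equation depends on injectivity of function types,
  which is still to be shown. The equation is therefore carried along with the reduction.\<close>

definition red :: "ctx \<Rightarrow> exp \<Rightarrow> exp \<Rightarrow> bool" where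
  "red \<Delta> A W \<longleftrightarrow> step\<^sup>*\<^sup>* A W \<and> teq \<Delta> A W"

lemma red_refl: "\<Delta> \<tturnstile> A \<^bold>: Sort s \<Longrightarrow> red \<Delta> A A"
  by (simp add: red_def teq_refl)

lemma red_expand: "step A' A \<Longrightarrow> teq \<Delta> A' A \<Longrightarrow> red \<Delta> A W \<Longrightarrow> red \<Delta> A' W"
  unfolding red_def by (meson teq_trans converse_rtranclp_into_rtranclp)

lemma red_teq: "red \<Delta> A W \<Longrightarrow> red \<Delta> B W' \<Longrightarrow> teq \<Delta> A B \<Longrightarrow> teq \<Delta> W W'"
  and red_teq_rev: "red \<Delta> A W \<Longrightarrow> red \<Delta> B W' \<Longrightarrow> teq \<Delta> W W' \<Longrightarrow> teq \<Delta> A B"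
  unfolding red_def by (meson teq_trans teq_sym)+

lemma red_cnv: "red \<Delta> A W \<Longrightarrow> \<Delta> \<tturnstile> t \<^bold>= t' \<^bold>: A \<longleftrightarrow> \<Delta> \<tturnstile> t \<^bold>= t' \<^bold>: W"
  unfolding red_def by (meson cnv_teq teq_sym)

text \<open>An equality of predicates, because the element relation is an argument of
  \<open>LR\<close> and must stay the same when one type is replaced by another.\<close>

lemma teq_cnv_fun: "teq \<Delta> A B \<Longrightarrow> (\<lambda>t t'. \<Delta> \<tturnstile> t \<^bold>= t' \<^bold>: A) = (\<lambda>t t'. \<Delta> \<tturnstile> t \<^bold>= t' \<^bold>: B)"
  by (intro ext) (meson cnv_teq teq_sym)

lemma teq_irr_fun:
  "teq \<Delta> U U' \<Longrightarrow> (\<lambda>u u'. resurrect \<Delta> \<tturnstile> u \<^bold>: U \<and> resurrect \<Delta> \<tturnstile> u' \<^bold>: U)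
    = (\<lambda>u u'. resurrect \<Delta> \<tturnstile> u \<^bold>: U' \<and> resurrect \<Delta> \<tturnstile> u' \<^bold>: U')"
  by (intro ext) (meson typ_teq teq_sym teq_resurrect)


section \<open>The logical relation\<close>

text \<open>
  \<open>LR P K \<Delta> A B R\<close> says that \<open>A\<close> and \<open>B\<close> are related types in \<open>\<Delta>\<close> and that \<open>R\<close> relates their
  elements, where \<open>K i\<close> tells whether the universe \<open>Set i\<close> may be used and \<open>P i\<close> relates its
  elements. There are no Kripke worlds: the domain and codomain of function types are compared
  judgementally in addition, which is what makes function types injective, and irrelevant
  arguments need only be well-typed.
\<close>

inductive LR :: "(nat \<Rightarrow> exp \<Rightarrow> exp \<Rightarrow> bool) \<Rightarrow> (nat \<Rightarrow> bool) \<Rightarrow> ctx \<Rightarrow> exp \<Rightarrow> exp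
    \<Rightarrow> (exp \<Rightarrow> exp \<Rightarrow> bool) \<Rightarrow> bool" for P K \<Delta> where
  LR_sort: "\<lbrakk>K i; red \<Delta> A (Sort (Set i)); red \<Delta> B (Sort (Set i))\<rbrakk>
    \<Longrightarrow> LR P K \<Delta> A B (\<lambda>t t'. \<Delta> \<tturnstile> t \<^bold>= t' \<^bold>: Sort (Set i) \<and> P i t t')"
| LR_neutral: "\<lbrakk>red \<Delta> A N; red \<Delta> B N'; neutral N; neutral N'; teq \<Delta> N N'\<rbrakk>
    \<Longrightarrow> LR P K \<Delta> A B (\<lambda>t t'. \<Delta> \<tturnstile> t \<^bold>= t' \<^bold>: N)"
| LR_pi: "\<lbrakk>red \<Delta> A (Pi a s s' U T); red \<Delta> B (Pi a s s' U' T'); teq \<Delta> A B;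
      teq \<Delta> U U'; teq ((a, U) # \<Delta>) T T';
      a = Relevant \<longrightarrow> LR P K \<Delta> U U' RU;
      a = Irrelevant \<longrightarrow> RU = (\<lambda>u u'. resurrect \<Delta> \<tturnstile> u \<^bold>: U \<and> resurrect \<Delta> \<tturnstile> u' \<^bold>: U);
      \<And>u u'. RU u u' \<Longrightarrow> LR P K \<Delta> (inst u T) (inst u' T') (RT u u')\<rbrakk>
    \<Longrightarrow> LR P K \<Delta> A B (\<lambda>t t'. \<Delta> \<tturnstile> t \<^bold>= t' \<^bold>: Pi a s s' U T \<and>
          (\<forall>u u'. RU u u' \<longrightarrow> RT u u' (App a t u) (App a t' u')))"

section \<open>Inversion of the relation and uniqueness of the element relation\<close>

lemma LR_teq: "LR P K \<Delta> A B R \<Longrightarrow> teq \<Delta> A B"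
proof (induction rule: LR.induct)
  case (LR_sort i A B)
  then show ?case by (meson red_def teq_trans teq_sym)
qed (auto intro: red_teq_rev)

lemma LR_escape: "LR P K \<Delta> A B R \<Longrightarrow> R t t' \<Longrightarrow> \<Delta> \<tturnstile> t \<^bold>= t' \<^bold>: A"
  by (induction rule: LR.induct) (auto simp: red_cnv)

lemma LR_whnf:
  "LR P K \<Delta> A B R \<Longrightarrow> \<exists>W. red \<Delta> A W \<and> whnf W"
  by (induction rule: LR.induct) (force intro: whnf_simps)+

text \<open>\<open>P\<close> is consulted only at levels that \<open>K\<close> admits. This allows
  level bounds to be raised, and the truncated family in the definition of \<open>univ\<close> to be
  exchanged for \<open>univ\<close> itself.\<close>

lemma LR_cong: "LR P K \<Delta> A B R \<Longrightarrow> (\<And>i. K i \<Longrightarrow> K' i \<and> P i = P' i) \<Longrightarrow> LR P' K' \<Delta> A B R"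
proof (induction rule: LR.induct)
  case (LR_sort i A B)
  then have "P i = P' i" "K' i" by auto
  then show ?case using LR.LR_sort[of K' i \<Delta> A B P'] LR_sort by simp
next
  case (LR_neutral A N B N')
  then show ?case by (auto intro: LR.LR_neutral)
next
  case (LR_pi A a s s' U T B U' T' RU RT)
  then show ?case by (intro LR.LR_pi) auto
qed

text \<open>Weak head normal forms are unique, so the one of the left type decides which clause was
  used. The next two lemmas invert the other clauses in the same way.\<close>

lemma LR_sortD:
  assumes "LR P K \<Delta> A B R" "step\<^sup>*\<^sup>* A (Sort (Set i))"
  shows "K i \<and> red \<Delta> A (Sort (Set i)) \<and> red \<Delta> B (Sort (Set i)) \<and>
    R = (\<lambda>t t'. \<Delta> \<tturnstile> t \<^bold>= t' \<^bold>: Sort (Set i) \<and> P i t t')"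
  using assms(1)
proof cases
  case (LR_sort j)
  then have "Sort (Set j) = Sort (Set i)"
    using assms(2) by (intro whnf_unique[of A]) (auto simp: red_def)
  then show ?thesis using LR_sort by auto
next
  case (LR_neutral N N')
  then have "N = Sort (Set i)"
    using assms(2) by (intro whnf_unique[of A]) (auto simp: red_def)
  then show ?thesis using LR_neutral by simp
next
  case (LR_pi a s s' U T U' T' RU RT)
  then have "Pi a s s' U T = Sort (Set i)"
    using assms(2) by (intro whnf_unique[of A]) (auto simp: red_def)
  then show ?thesis by simp
qed

lemma LR_neutralD:
  assumes "LR P K \<Delta> A B R" "step\<^sup>*\<^sup>* A N" "neutral N"
  shows "\<exists>N'. red \<Delta> A N \<and> red \<Delta> B N' \<and> neutral N' \<and> teq \<Delta> N N' \<and> R = (\<lambda>t t'. \<Delta> \<tturnstile> t \<^bold>= t' \<^bold>: N)"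
  using assms(1)
proof cases
  case (LR_sort j)
  then have "Sort (Set j) = N"
    using assms by (intro whnf_unique[of A]) (auto simp: red_def)
  then show ?thesis using assms by auto
next
  case (LR_neutral M N')
  then have "M = N"
    using assms by (intro whnf_unique[of A]) (auto simp: red_def)
  then show ?thesis using LR_neutral by blast
next
  case (LR_pi a s s' U T U' T' RU RT)
  then have "Pi a s s' U T = N"
    using assms by (intro whnf_unique[of A]) (auto simp: red_def)
  then show ?thesis using assms by auto
qed

lemma LR_piD:
  assumes "LR P K \<Delta> A B R" "step\<^sup>*\<^sup>* A (Pi a s s' U T)"
  obtains U' T' RU RT where "red \<Delta> A (Pi a s s' U T)" "red \<Delta> B (Pi a s s' U' T')" "teq \<Delta> A B"
    "teq \<Delta> U U'" "teq ((a, U) # \<Delta>) T T'" "a = Relevant \<longrightarrow> LR P K \<Delta> U U' RU"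
    "a = Irrelevant \<longrightarrow> RU = (\<lambda>u u'. resurrect \<Delta> \<tturnstile> u \<^bold>: U \<and> resurrect \<Delta> \<tturnstile> u' \<^bold>: U)"
    "\<forall>u u'. RU u u' \<longrightarrow> LR P K \<Delta> (inst u T) (inst u' T') (RT u u')"
    "R = (\<lambda>t t'. \<Delta> \<tturnstile> t \<^bold>= t' \<^bold>: Pi a s s' U T \<and>
          (\<forall>u u'. RU u u' \<longrightarrow> RT u u' (App a t u) (App a t' u')))"
  using assms(1)
proof cases
  case (LR_sort j)
  then have "Sort (Set j) = Pi a s s' U T"
    using assms by (intro whnf_unique[of A]) (auto simp: red_def)
  then show ?thesis by simp
next
  case (LR_neutral M N')
  then have "M = Pi a s s' U T"
    using assms by (intro whnf_unique[of A]) (auto simp: red_def)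
  then show ?thesis using LR_neutral by simp
next
  case (LR_pi b r r' V S U' T' RU RT)
  then have "Pi b r r' V S = Pi a s s' U T"
    using assms by (intro whnf_unique[of A]) (auto simp: red_def)
  then show ?thesis using LR_pi by (intro that[of U' T' RU RT]) auto
qed

text \<open>The normal form of the left type fixes the clause, and the induction hypotheses fix the
  relations on domain and codomain. Right types and level bounds may differ; this is how element
  relations from unrelated derivations are identified throughout.\<close>

lemma LR_unique: "LR P K \<Delta> A B R \<Longrightarrow> LR P K' \<Delta> A B' R' \<Longrightarrow> R = R'"
proof (induction arbitrary: B' R' rule: LR.induct)
  case (LR_sort i A B)
  then show ?case by (auto simp: red_def dest: LR_sortD)
next
  case (LR_neutral A N B N')
  then show ?case by (auto simp: red_def dest: LR_neutralD)
next
  case (LR_pi A a s s' U T B U' T' RU RT)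
  have "step\<^sup>*\<^sup>* A (Pi a s s' U T)" using LR_pi.hyps by (simp add: red_def)
  with LR_pi.prems obtain U2 T2 RU2 RT2 where 2: "red \<Delta> A (Pi a s s' U T)"
    "red \<Delta> B' (Pi a s s' U2 T2)" "teq \<Delta> A B'" "teq \<Delta> U U2" "teq ((a, U) # \<Delta>) T T2"
    "a = Relevant \<longrightarrow> LR P K' \<Delta> U U2 RU2"
    "a = Irrelevant \<longrightarrow> RU2 = (\<lambda>u u'. resurrect \<Delta> \<tturnstile> u \<^bold>: U \<and> resurrect \<Delta> \<tturnstile> u' \<^bold>: U)"
    "\<forall>u u'. RU2 u u' \<longrightarrow> LR P K' \<Delta> (inst u T) (inst u' T2) (RT2 u u')"
    "R' = (\<lambda>t t'. \<Delta> \<tturnstile> t \<^bold>= t' \<^bold>: Pi a s s' U T \<and>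
          (\<forall>u u'. RU2 u u' \<longrightarrow> RT2 u u' (App a t u) (App a t' u')))"
    by (rule LR_piD)
  have "RU = RU2" using LR_pi.IH(1) LR_pi.hyps 2(6,7) by (cases a) auto
  \<comment> \<open>Codomain relations are determined at related arguments only, which is where the
    element relation consults them.\<close>
  moreover have "RT u u' = RT2 u u'" if "RU u u'" for u u'
    using LR_pi.IH(2)[OF that] 2(8) that \<open>RU = RU2\<close> by blast
  ultimately show ?case unfolding 2(9) by (intro ext) auto
qed

lemma LR_expand: "LR P K \<Delta> A B R \<Longrightarrow> step A' A \<Longrightarrow> teq \<Delta> A' A \<Longrightarrow> LR P K \<Delta> A' B R"
proof (induction rule: LR.induct)
  case (LR_sort i A B)
  then show ?case by (blast intro: LR.LR_sort red_expand)
next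
  case (LR_neutral A N B N')
  then show ?case by (blast intro: LR.LR_neutral red_expand)
next
  case (LR_pi A a s s' U T B U' T' RU RT)
  have "teq \<Delta> A' B" using LR_pi.prems LR_pi.hyps by (blast intro: teq_trans)
  moreover have "red \<Delta> A' (Pi a s s' U T)" using LR_pi.prems LR_pi.hyps by (blast intro: red_expand)
  ultimately show ?case using LR_pi.hyps LR_pi.IH by (intro LR.LR_pi[where U'=U' and T'=T']) auto
qed

text \<open>Symmetry of the types keeps \<open>R\<close> and is proved together with the laws for
  \<open>R\<close>: swapping two function types also swaps their arguments, and this uses symmetry
  and transitivity of the relation on the domain.\<close>

lemma LR_per:
  assumes "LR P K \<Delta> A B R" and per: "\<And>i. K i \<Longrightarrow> symp (P i) \<and> transp (P i)"
  shows "LR P K \<Delta> B A R \<and> symp R \<and> transp R"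
  using assms(1)
proof (induction rule: LR.induct)
  case (LR_sort i A B)
  then have "symp (P i)" "transp (P i)" using per by auto
  then have "symp (\<lambda>t t'. \<Delta> \<tturnstile> t \<^bold>= t' \<^bold>: Sort (Set i) \<and> P i t t')"
    "transp (\<lambda>t t'. \<Delta> \<tturnstile> t \<^bold>= t' \<^bold>: Sort (Set i) \<and> P i t t')"
    unfolding symp_def transp_def by (meson cnv_sym cnv_trans)+
  then show ?case using LR_sort by (auto intro: LR.LR_sort)
next
  case (LR_neutral A N B N')
  have "(\<lambda>t t'. \<Delta> \<tturnstile> t \<^bold>= t' \<^bold>: N) = (\<lambda>t t'. \<Delta> \<tturnstile> t \<^bold>= t' \<^bold>: N')"
    using LR_neutral by (intro teq_cnv_fun)
  moreover have "LR P K \<Delta> B A (\<lambda>t t'. \<Delta> \<tturnstile> t \<^bold>= t' \<^bold>: N')"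
    using LR_neutral by (intro LR.LR_neutral[where N'=N]) (auto intro: teq_sym)
  moreover have "symp (\<lambda>t t'. \<Delta> \<tturnstile> t \<^bold>= t' \<^bold>: N)" "transp (\<lambda>t t'. \<Delta> \<tturnstile> t \<^bold>= t' \<^bold>: N)"
    unfolding symp_def transp_def by (meson cnv_sym cnv_trans)+
  ultimately show ?case by simp
next
  case (LR_pi A a s s' U T B U' T' RU RT)
  have irr: "a = Irrelevant \<longrightarrow> RU = (\<lambda>u u'. resurrect \<Delta> \<tturnstile> u \<^bold>: U \<and> resurrect \<Delta> \<tturnstile> u' \<^bold>: U)"
    by (fact LR_pi.hyps)
  have RU: "symp RU \<and> transp RU"
  proof (cases a)
    case Relevant
    then show ?thesis using LR_pi.IH(1) by blast
  next
    case Irrelevant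
    then show ?thesis using irr by (auto simp: symp_def transp_def)
  qed
  have UU': "teq \<Delta> U U'" by (fact LR_pi.hyps)
  have refl: "RU u u \<and> RU u' u' \<and> RU u' u" if "RU u u'" for u u'
    using RU that by (meson sympD transpD)
  have IH: "LR P K \<Delta> (inst u T) (inst u' T') (RT u u')" "LR P K \<Delta> (inst u' T') (inst u T) (RT u u')"
    "symp (RT u u')" "transp (RT u u')" if "RU u u'" for u u'
    using LR_pi.hyps(7)[OF that] LR_pi.IH(2)[OF that] by auto
  \<comment> \<open>All four combinations of two related arguments yield one relation:
    \<open>inst u T\<close> fixes it from the left, \<open>inst u' T'\<close> from the right by
    symmetry, and \<open>inst u' T\<close> connects the swapped pair.\<close>
  have RT: "RT u u' = RT u u" "RT u u' = RT u' u'" "RT u' u = RT u u'" if "RU u u'" for u u'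
  proof -
    note r = refl[OF that]
    show 1: "RT u u' = RT u u" using LR_unique[OF IH(1)[of u u'] IH(1)[of u u]] that r by blast
    show 2: "RT u u' = RT u' u'" using LR_unique[OF IH(2)[of u u'] IH(2)[of u' u']] that r by blast
    show "RT u' u = RT u u'" using LR_unique[OF IH(1)[of u' u] IH(1)[of u' u']] 2 r by simp
  qed
  let ?R = "\<lambda>t t'. \<Delta> \<tturnstile> t \<^bold>= t' \<^bold>: Pi a s s' U T \<and>
          (\<forall>u u'. RU u u' \<longrightarrow> RT u u' (App a t u) (App a t' u'))"
  let ?R' = "\<lambda>t t'. \<Delta> \<tturnstile> t \<^bold>= t' \<^bold>: Pi a s s' U' T' \<and>
          (\<forall>u u'. RU u u' \<longrightarrow> RT u u' (App a t u) (App a t' u'))"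
  have pis: "teq \<Delta> (Pi a s s' U T) (Pi a s s' U' T')"
    using LR_pi.hyps by (blast intro: red_teq)
  have "?R = ?R'" using teq_cnv_fun[OF pis] by (auto simp: fun_eq_iff)
  moreover have "LR P K \<Delta> B A ?R'"
  proof (rule LR.LR_pi)
    show "a = Irrelevant \<longrightarrow> RU = (\<lambda>u u'. resurrect \<Delta> \<tturnstile> u \<^bold>: U' \<and> resurrect \<Delta> \<tturnstile> u' \<^bold>: U')"
      using irr teq_irr_fun[OF UU'] by simp
    show "teq ((a, U') # \<Delta>) T' T" using LR_pi.hyps(5) UU' by (blast intro: teq_ctx_conv teq_sym)
    show "LR P K \<Delta> (inst u T') (inst u' T) (RT u u')" if "RU u u'" for u u'
      using IH(2)[of u' u] RT(3)[OF that] refl[OF that] by simp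
  qed (use LR_pi in \<open>auto intro: teq_sym\<close>)
  moreover have "symp ?R"
  proof (rule sympI)
    fix t t' assume R: "?R t t'"
    have "RT u u' (App a t' u) (App a t u')" if "RU u u'" for u u'
      using R IH(3)[OF that] RT(3)[OF that] refl[OF that] by (metis sympD)
    then show "?R t' t" using R by (blast intro: cnv_sym)
  qed
  moreover have "transp ?R"
  proof (rule transpI)
    fix t t' t'' assume R: "?R t t'" "?R t' t''"
    have "RT u u' (App a t u) (App a t'' u')" if "RU u u'" for u u'
    proof -
      have "RT u u' (App a t u) (App a t' u')" using R that by blast
      moreover have "RT u' u' (App a t' u') (App a t'' u')" using R refl[OF that] by blast
      ultimately show ?thesis using RT(2)[OF that] IH(4)[OF that] by (metis transpD)
    qed
    then show "?R t t''" using R by (meson cnv_trans)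
  qed
  ultimately show ?case by simp
qed

lemma LR_trans:
  assumes "LR P K \<Delta> A B R" "LR P K \<Delta> B C R'" and per: "\<And>i. K i \<Longrightarrow> symp (P i) \<and> transp (P i)"
  shows "LR P K \<Delta> A C R"
proof -
  have LR_sym_trans: "LR P K \<Delta> B A R \<and> symp R \<and> transp R" if "LR P K \<Delta> A B R" for A B R
    using LR_per[OF that] per by blast
  show ?thesis
    using assms(1,2)
  proof (induction arbitrary: C R' rule: LR.induct)
    case (LR_sort i A B)
    then show ?case by (auto simp: red_def dest: LR_sortD intro!: LR.LR_sort)
  next
    case (LR_neutral A N B N')
    obtain N2 where "red \<Delta> C N2" "neutral N2" "teq \<Delta> N' N2"
      using LR_neutralD[OF LR_neutral.prems] LR_neutral.hyps by (auto simp: red_def)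
    with LR_neutral show ?case by (blast intro: LR.LR_neutral teq_trans)
  next
    case (LR_pi A a s s' U T B U' T' RU RT)
    have step: "step\<^sup>*\<^sup>* B (Pi a s s' U' T')" using LR_pi.hyps by (simp add: red_def)
    from LR_pi.prems step obtain U2 T2 RU2 RT2 where 2: "red \<Delta> B (Pi a s s' U' T')"
      "red \<Delta> C (Pi a s s' U2 T2)" "teq \<Delta> B C"
      "teq \<Delta> U' U2" "teq ((a, U') # \<Delta>) T' T2" "a = Relevant \<longrightarrow> LR P K \<Delta> U' U2 RU2"
      "a = Irrelevant \<longrightarrow> RU2 = (\<lambda>u u'. resurrect \<Delta> \<tturnstile> u \<^bold>: U' \<and> resurrect \<Delta> \<tturnstile> u' \<^bold>: U')"
      "\<forall>u u'. RU2 u u' \<longrightarrow> LR P K \<Delta> (inst u T') (inst u' T2) (RT2 u u')"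
      "R' = (\<lambda>t t'. \<Delta> \<tturnstile> t \<^bold>= t' \<^bold>: Pi a s s' U' T' \<and>
            (\<forall>u u'. RU2 u u' \<longrightarrow> RT2 u u' (App a t u) (App a t' u')))"
      by (rule LR_piD)
    have irr: "a = Irrelevant \<longrightarrow> RU = (\<lambda>u u'. resurrect \<Delta> \<tturnstile> u \<^bold>: U \<and> resurrect \<Delta> \<tturnstile> u' \<^bold>: U)"
      by (fact LR_pi.hyps)
    have UU': "teq \<Delta> U U'" by (fact LR_pi.hyps)
    \<comment> \<open>For relevant domains both relations belong to the middle type
      \<open>U'\<close>, the first one by symmetry, so \<open>LR_unique\<close> identifies
      them.\<close>
    have RU2: "RU2 = RU"
    proof (cases a)
      case Relevant
      then have "LR P K \<Delta> U U' RU" "LR P K \<Delta> U' U2 RU2" using LR_pi.IH(1) 2(6) by blast+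
      then show ?thesis using LR_sym_trans LR_unique by blast
    next
      case Irrelevant
      then show ?thesis using irr 2(7) teq_irr_fun[OF UU'] by simp
    qed
    have RU: "symp RU \<and> transp RU"
    proof (cases a)
      case Relevant
      then show ?thesis using LR_pi.IH(1) LR_sym_trans by blast
    next
      case Irrelevant
      then show ?thesis using irr by (auto simp: symp_def transp_def)
    qed
    show ?case
    proof (rule LR.LR_pi)
      show "teq ((a, U) # \<Delta>) T T2"
        using LR_pi.hyps(5) teq_ctx_conv[OF teq_sym[OF UU'] 2(5)] by (rule teq_trans)
      show "a = Relevant \<longrightarrow> LR P K \<Delta> U U2 RU" using LR_pi.IH(1) 2(6) by blast
      \<comment> \<open>The first derivation changes the argument from \<open>u\<close> to
        \<open>u'\<close>; the second is used at the reflexive pair \<open>u'\<close>,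
        \<open>u'\<close>.\<close>
      show "LR P K \<Delta> (inst u T) (inst u' T2) (RT u u')" if "RU u u'" for u u'
      proof -
        have "RU u' u'" using RU that by (meson sympD transpD)
        then show ?thesis using LR_pi.IH(2)[OF that] 2(8) RU2 by blast
      qed
      show "teq \<Delta> A C" using LR_pi.hyps 2(3) by (blast intro: teq_trans)
      show "teq \<Delta> U U2" using LR_pi.hyps 2(4) by (blast intro: teq_trans)
    qed (use LR_pi.hyps 2 RU2 in auto)
  qed
qed

text \<open>Elements of \<open>Set j\<close> are types whose relation uses universes below
  \<open>j\<close> only. The constantly false relation at other levels is a default value that keeps
  the recursive calls below \<open>j\<close>; \<open>univ_rty\<close> removes it.\<close>

function univ :: "ctx \<Rightarrow> nat \<Rightarrow> exp \<Rightarrow> exp \<Rightarrow> bool" where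
  "univ \<Delta> j = (\<lambda>A B. \<exists>R. LR (\<lambda>i. if i < j then univ \<Delta> i else (\<lambda>_ _. False)) (\<lambda>i. i < j) \<Delta> A B R)"
  by auto
termination by (relation "measure snd") auto

declare univ.simps [simp del]

definition rty :: "(nat \<Rightarrow> bool) \<Rightarrow> ctx \<Rightarrow> exp \<Rightarrow> exp \<Rightarrow> bool" where
  "rty K \<Delta> A B \<longleftrightarrow> (\<exists>R. LR (univ \<Delta>) K \<Delta> A B R)"

lemma univ_rty: "univ \<Delta> j = rty (\<lambda>i. i < j) \<Delta>"
proof (intro ext)
  fix A B
  have "LR (\<lambda>i. if i < j then univ \<Delta> i else (\<lambda>_ _. False)) (\<lambda>i. i < j) \<Delta> A B R
    \<longleftrightarrow> LR (univ \<Delta>) (\<lambda>i. i < j) \<Delta> A B R" for R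
    by (auto elim: LR_cong)
  then show "univ \<Delta> j A B = rty (\<lambda>i. i < j) \<Delta> A B"
    unfolding rty_def by (subst univ.simps) blast
qed

lemma rty_mono: "rty K \<Delta> A B \<Longrightarrow> (\<And>i. K i \<Longrightarrow> K' i) \<Longrightarrow> rty K' \<Delta> A B"
  unfolding rty_def by (blast intro: LR_cong)

text \<open>At bound \<open>j\<close>, \<open>LR_per\<close> and \<open>LR_trans\<close> ask for the
  laws only at universes below \<open>j\<close>, so strong induction on the level suffices.\<close>

lemma univ_per: "symp (univ \<Delta> j) \<and> transp (univ \<Delta> j)"
proof (induction j rule: less_induct)
  case (less j)
  have "symp (rty (\<lambda>i. i < j) \<Delta>)"
    unfolding rty_def symp_def by (meson LR_per less)
  moreover have "transp (rty (\<lambda>i. i < j) \<Delta>)"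
    unfolding rty_def transp_def by (meson LR_trans less)
  ultimately show ?case by (simp add: univ_rty)
qed

lemmas LR_univ_per = LR_per[of "univ \<Delta>" K \<Delta>, OF _ univ_per] for \<Delta> K
lemmas LR_univ_trans = LR_trans[of "univ \<Delta>" K \<Delta>, OF _ _ univ_per] for \<Delta> K

lemma rty_sym: "rty K \<Delta> A B \<Longrightarrow> rty K \<Delta> B A"
  unfolding rty_def using LR_univ_per by blast

lemma rty_trans: "rty K \<Delta> A B \<Longrightarrow> rty K \<Delta> B C \<Longrightarrow> rty K \<Delta> A C"
  unfolding rty_def using LR_univ_trans by blast

text \<open>In a universe a neutral term is a neutral type, and a neutral function stays neutral
  when applied. This makes relevant variables related to themselves, and so gives access to the
  identity substitution.\<close>

lemma LR_neutral_term:
  "LR (univ \<Delta>) K \<Delta> A B R \<Longrightarrow> neutral n \<Longrightarrow> neutral n' \<Longrightarrow> \<Delta> \<tturnstile> n \<^bold>= n' \<^bold>: A \<Longrightarrow> R n n'"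
proof (induction arbitrary: n n' rule: LR.induct)
  case (LR_sort i A B)
  then have n: "\<Delta> \<tturnstile> n \<^bold>= n' \<^bold>: Sort (Set i)" by (auto simp: red_cnv)
  then have "LR (univ \<Delta>) (\<lambda>j. j < i) \<Delta> n n' (\<lambda>t t'. \<Delta> \<tturnstile> t \<^bold>= t' \<^bold>: n)"
    using LR_sort cnv_valid[OF n] by (intro LR.LR_neutral[where N'=n']) (auto intro: red_refl teqI)
  then show ?case using n by (auto simp: univ_rty rty_def)
next
  case (LR_neutral A N B N')
  then show ?case by (auto simp: red_cnv)
next
  case (LR_pi A a s s' U T B U' T' RU RT)
  have n: "\<Delta> \<tturnstile> n \<^bold>= n' \<^bold>: Pi a s s' U T" using LR_pi by (auto simp: red_cnv)
  then have UT: "\<Delta> \<tturnstile> U \<^bold>: Sort s" "(a, U) # \<Delta> \<tturnstile> T \<^bold>: Sort s'"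
    by (auto dest!: cnv_valid typ_pi_inv)
  have "\<Delta> \<tturnstile> App a n u \<^bold>= App a n' u' \<^bold>: inst u T" if "RU u u'" for u u'
  proof (cases a)
    case Relevant
    then have "\<Delta> \<tturnstile> u \<^bold>= u' \<^bold>: U" using LR_pi.IH(1) that LR_escape by blast
    then show ?thesis using n UT Relevant by (auto intro: cnv_app)
  next
    case Irrelevant
    then show ?thesis using n UT that LR_pi.hyps by (auto intro: cnv_app_irr)
  qed
  then have "RT u u' (App a n u) (App a n' u')" if "RU u u'" for u u'
    using LR_pi.IH(2)[OF that] LR_pi.prems that by (blast intro: neutral_app)
  then show ?case using n by blast
qed

text \<open>This brings beta into the model. The equation between redex and contractum is assumed,
  since reduction does not provide it yet; at a universe the claim becomes \<open>LR_expand\<close>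
  for types.\<close>

lemma LR_expand_term:
  "LR (univ \<Delta>) K \<Delta> A B R \<Longrightarrow> R t t' \<Longrightarrow> step r t \<Longrightarrow> \<Delta> \<tturnstile> r \<^bold>= t \<^bold>: A \<Longrightarrow> R r t'"
proof (induction arbitrary: t t' r rule: LR.induct)
  case (LR_sort i A B)
  then have r: "\<Delta> \<tturnstile> r \<^bold>= t \<^bold>: Sort (Set i)" by (auto simp: red_cnv)
  then have "univ \<Delta> i r t'"
    using LR_sort by (auto simp: univ_rty rty_def intro: LR_expand teqI)
  then show ?case using r LR_sort by (meson cnv_trans)
next
  case (LR_neutral A N B N')
  then show ?case by (meson red_cnv cnv_trans)
next
  case (LR_pi A a s s' U T B U' T' RU RT)
  have r: "\<Delta> \<tturnstile> r \<^bold>= t \<^bold>: Pi a s s' U T" using LR_pi by (auto simp: red_cnv)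
  then have UT: "\<Delta> \<tturnstile> U \<^bold>: Sort s" "(a, U) # \<Delta> \<tturnstile> T \<^bold>: Sort s'"
    by (auto dest!: cnv_valid typ_pi_inv)
  have "\<Delta> \<tturnstile> App a r u \<^bold>= App a t u \<^bold>: inst u T" if "RU u u'" for u u'
  proof (cases a)
    case Relevant
    then have "\<Delta> \<tturnstile> u \<^bold>= u' \<^bold>: U" using LR_pi.IH(1) that LR_escape by blast
    then have "\<Delta> \<tturnstile> u \<^bold>= u \<^bold>: U" by (blast intro: cnv_refl dest: cnv_valid)
    then show ?thesis using r UT Relevant by (auto intro: cnv_app)
  next
    case Irrelevant
    then show ?thesis using r UT that LR_pi.hyps by (auto intro: cnv_app_irr)
  qed
  then have "RT u u' (App a r u) (App a t' u')" if "RU u u'" for u u'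
    using LR_pi.IH(2)[OF that] LR_pi.prems that by (blast intro: step_app)
  then show ?case using r LR_pi.prems by (meson cnv_trans)
qed


section \<open>Related terms and related substitutions\<close>

text \<open>By \<open>LR_unique\<close> the witness is determined by the left type, so membership
  can be transferred between any two derivations.\<close>

definition rel :: "ctx \<Rightarrow> exp \<Rightarrow> exp \<Rightarrow> exp \<Rightarrow> exp \<Rightarrow> bool" where
  "rel \<Delta> A B t t' \<longleftrightarrow> (\<exists>R. LR (univ \<Delta>) (\<lambda>_. True) \<Delta> A B R \<and> R t t')"

abbreviation rtype :: "ctx \<Rightarrow> exp \<Rightarrow> exp \<Rightarrow> bool" where
  "rtype \<equiv> rty (\<lambda>_. True)"

text \<open>Each irrelevant argument is typed at its own domain. For equal domains this agrees with
  the condition in \<open>LR_pi\<close>, and it is visibly symmetric.\<close>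

definition rarg :: "ctx \<Rightarrow> ann \<Rightarrow> exp \<Rightarrow> exp \<Rightarrow> exp \<Rightarrow> exp \<Rightarrow> bool" where
  "rarg \<Delta> a U U' u u' \<longleftrightarrow> (case a of Relevant \<Rightarrow> rel \<Delta> U U' u u'
     | Irrelevant \<Rightarrow> resurrect \<Delta> \<tturnstile> u \<^bold>: U \<and> resurrect \<Delta> \<tturnstile> u' \<^bold>: U')"

lemma rty_teq: "rty K \<Delta> A B \<Longrightarrow> teq \<Delta> A B"
  unfolding rty_def using LR_teq by blast

lemma rty_refl: "rty K \<Delta> A B \<Longrightarrow> rty K \<Delta> A A"
  using rty_sym rty_trans by blast

lemma rel_rtype: "rel \<Delta> A B t t' \<Longrightarrow> rtype \<Delta> A B"
  unfolding rel_def rty_def by blast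

lemma rel_cnv: "rel \<Delta> A B t t' \<Longrightarrow> \<Delta> \<tturnstile> t \<^bold>= t' \<^bold>: A"
  unfolding rel_def using LR_escape by blast

lemma rel_sym: "rel \<Delta> A B t t' \<Longrightarrow> rel \<Delta> B A t' t"
  unfolding rel_def using LR_univ_per by (metis sympD)

lemma rel_trans:
  assumes "rel \<Delta> A B t t'" "rel \<Delta> B C t' t''"
  shows "rel \<Delta> A C t t''"
proof -
  obtain R where R: "LR (univ \<Delta>) (\<lambda>_. True) \<Delta> A B R" "R t t'" using assms(1) rel_def by blast
  obtain R' where R': "LR (univ \<Delta>) (\<lambda>_. True) \<Delta> B C R'" "R' t' t''" using assms(2) rel_def by blast
  have "R' = R" using LR_unique R'(1) LR_univ_per[OF R(1)] by blast
  moreover have "transp R" using LR_univ_per[OF R(1)] by blast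
  ultimately have "R t t''" using R(2) R'(2) by (metis transpD)
  then show ?thesis using LR_univ_trans[OF R(1) R'(1)] rel_def by blast
qed

lemma rel_cast_left:
  assumes "rel \<Delta> A B t t'" "rtype \<Delta> A A'"
  shows "rel \<Delta> A' B t t'"
proof -
  obtain R where R: "LR (univ \<Delta>) (\<lambda>_. True) \<Delta> A B R" "R t t'" using assms(1) rel_def by blast
  obtain R' where R': "LR (univ \<Delta>) (\<lambda>_. True) \<Delta> A A' R'" using assms(2) rty_def by blast
  have "R' = R" using LR_unique[OF R'(1) R(1)] .
  then have "LR (univ \<Delta>) (\<lambda>_. True) \<Delta> A' B R"
    using LR_univ_per[OF R'] LR_univ_trans[OF _ R(1)] by blast
  then show ?thesis using R(2) rel_def by blast
qed

lemma rel_cast: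
  assumes "rel \<Delta> A B t t'" "rtype \<Delta> A A'" "rtype \<Delta> A' B'"
  shows "rel \<Delta> A' B' t t'"
proof -
  have "rtype \<Delta> B B'"
    using rty_trans[OF rty_sym[OF rel_rtype[OF assms(1)]] rty_trans[OF assms(2,3)]] .
  then show ?thesis
    using rel_sym[OF rel_cast_left[OF rel_sym[OF rel_cast_left[OF assms(1,2)]]]] by blast
qed

lemma rel_expand_left:
  "rel \<Delta> A B t t' \<Longrightarrow> step r t \<Longrightarrow> \<Delta> \<tturnstile> r \<^bold>= t \<^bold>: A \<Longrightarrow> rel \<Delta> A B r t'"
  unfolding rel_def using LR_expand_term by blast

lemma rel_expand_right:
  "rel \<Delta> A B t t' \<Longrightarrow> step r t' \<Longrightarrow> \<Delta> \<tturnstile> r \<^bold>= t' \<^bold>: B \<Longrightarrow> rel \<Delta> A B t r"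
  by (blast intro: rel_expand_left rel_sym)

lemma rel_neutral:
  "rtype \<Delta> A B \<Longrightarrow> neutral n \<Longrightarrow> neutral n' \<Longrightarrow> \<Delta> \<tturnstile> n \<^bold>= n' \<^bold>: A \<Longrightarrow> rel \<Delta> A B n n'"
  unfolding rel_def rty_def using LR_neutral_term by blast

lemma rel_sort_iff:
  assumes "\<tturnstile> \<Delta>"
  shows "rel \<Delta> (Sort (Set i)) (Sort (Set i)) A B \<longleftrightarrow> \<Delta> \<tturnstile> A \<^bold>= B \<^bold>: Sort (Set i) \<and> rty (\<lambda>j. j < i) \<Delta> A B"
proof -
  have r: "red \<Delta> (Sort (Set i)) (Sort (Set i))" using assms by (auto intro: red_refl typ_sort)
  have "LR (univ \<Delta>) (\<lambda>_. True) \<Delta> (Sort (Set i)) (Sort (Set i))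
    (\<lambda>t t'. \<Delta> \<tturnstile> t \<^bold>= t' \<^bold>: Sort (Set i) \<and> univ \<Delta> i t t')"
    using LR_sort[OF _ r r] by simp
  then show ?thesis
    unfolding rel_def univ_rty[symmetric] using LR_unique by blast
qed

lemma rel_sort_rtype: "rel \<Delta> (Sort (Set i)) (Sort (Set i)) A B \<Longrightarrow> rtype \<Delta> A B"
  using rel_sort_iff rel_cnv cnv_wfc rty_mono by metis

lemma rty_piI:
  assumes "teq \<Delta> (Pi a s s' U T) (Pi a s s' U' T')" "teq \<Delta> U U'" "teq ((a, U) # \<Delta>) T T'"
    and "a = Relevant \<Longrightarrow> rty K \<Delta> U U'"
    and T: "\<And>u u'. rarg \<Delta> a U U' u u' \<Longrightarrow> rty K \<Delta> (inst u T) (inst u' T')"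
  shows "rty K \<Delta> (Pi a s s' U T) (Pi a s s' U' T')"
proof -
  obtain RU where RU: "a = Relevant \<longrightarrow> LR (univ \<Delta>) K \<Delta> U U' RU"
    "a = Irrelevant \<longrightarrow> RU = (\<lambda>u u'. resurrect \<Delta> \<tturnstile> u \<^bold>: U \<and> resurrect \<Delta> \<tturnstile> u' \<^bold>: U)"
    using assms(4) by (cases a) (auto simp: rty_def)
  have "rarg \<Delta> a U U' u u'" if "RU u u'" for u u'
  proof (cases a)
    case Relevant
    then have "LR (univ \<Delta>) (\<lambda>_. True) \<Delta> U U' RU" using RU by (auto elim: LR_cong)
    then show ?thesis using that Relevant by (auto simp: rarg_def rel_def)
  next
    case Irrelevant
    then show ?thesis using that RU(2) typ_teq[OF _ teq_resurrect[OF assms(2)]] by (simp add: rarg_def)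
  qed
  then have "\<exists>R. LR (univ \<Delta>) K \<Delta> (inst u T) (inst u' T') R" if "RU u u'" for u u'
    using T that by (simp add: rty_def)
  \<comment> \<open>Choice: one relation for each pair of related arguments, collected into a
    function.\<close>
  then obtain RT where "\<And>u u'. RU u u' \<Longrightarrow> LR (univ \<Delta>) K \<Delta> (inst u T) (inst u' T') (RT u u')"
    by metis
  moreover have "red \<Delta> (Pi a s s' U T) (Pi a s s' U T)" "red \<Delta> (Pi a s s' U' T') (Pi a s s' U' T')"
    using teq_typ[OF assms(1)] by (auto intro: red_refl)
  ultimately show ?thesis unfolding rty_def using LR_pi[OF _ _ assms(1-3) RU] by blast
qed

text \<open>Inversion with \<open>rarg\<close> in place of the domain relation of some derivation,
  so that introduction and elimination of related functions quantify over the same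
  arguments.\<close>

lemma rtype_piE:
  assumes "rtype \<Delta> (Pi a s s' U T) (Pi a s s' U' T')"
  obtains RT where "teq \<Delta> U U'" "teq ((a, U) # \<Delta>) T T'"
    "a = Relevant \<longrightarrow> rtype \<Delta> U U'"
    "\<forall>u u'. rarg \<Delta> a U U' u u' \<longrightarrow> LR (univ \<Delta>) (\<lambda>_. True) \<Delta> (inst u T) (inst u' T') (RT u u')"
    "LR (univ \<Delta>) (\<lambda>_. True) \<Delta> (Pi a s s' U T) (Pi a s s' U' T')
       (\<lambda>t t'. \<Delta> \<tturnstile> t \<^bold>= t' \<^bold>: Pi a s s' U T \<and>
          (\<forall>u u'. rarg \<Delta> a U U' u u' \<longrightarrow> RT u u' (App a t u) (App a t' u')))"
proof -
  obtain R where R: "LR (univ \<Delta>) (\<lambda>_. True) \<Delta> (Pi a s s' U T) (Pi a s s' U' T') R"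
    using assms rty_def by blast
  obtain V S RU RT where 2: "red \<Delta> (Pi a s s' U T) (Pi a s s' U T)"
    "red \<Delta> (Pi a s s' U' T') (Pi a s s' V S)" "teq \<Delta> (Pi a s s' U T) (Pi a s s' U' T')"
    "teq \<Delta> U V" "teq ((a, U) # \<Delta>) T S" "a = Relevant \<longrightarrow> LR (univ \<Delta>) (\<lambda>_. True) \<Delta> U V RU"
    "a = Irrelevant \<longrightarrow> RU = (\<lambda>u u'. resurrect \<Delta> \<tturnstile> u \<^bold>: U \<and> resurrect \<Delta> \<tturnstile> u' \<^bold>: U)"
    "\<forall>u u'. RU u u' \<longrightarrow> LR (univ \<Delta>) (\<lambda>_. True) \<Delta> (inst u T) (inst u' S) (RT u u')"
    "R = (\<lambda>t t'. \<Delta> \<tturnstile> t \<^bold>= t' \<^bold>: Pi a s s' U T \<and>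
          (\<forall>u u'. RU u u' \<longrightarrow> RT u u' (App a t u) (App a t' u')))"
    by (rule LR_piD[OF R rtranclp.rtrancl_refl])
  have "Pi a s s' U' T' = Pi a s s' V S"
    using 2(2) by (intro whnf_unique[of "Pi a s s' U' T'"]) (auto simp: red_def)
  then have [simp]: "V = U'" "S = T'" by auto
  have RU: "RU = rarg \<Delta> a U U'"
  proof (cases a)
    case Relevant
    have "LR (univ \<Delta>) (\<lambda>_. True) \<Delta> U U' RU" using 2(6) Relevant by simp
    then have "rel \<Delta> U U' u u' \<longleftrightarrow> RU u u'" for u u'
      unfolding rel_def using LR_unique by blast
    then show ?thesis using Relevant by (simp add: rarg_def fun_eq_iff)
  next
    case Irrelevant
    have "teq (resurrect \<Delta>) U U'" using 2(4) teq_resurrect by simp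
    then have "resurrect \<Delta> \<tturnstile> u \<^bold>: U \<longleftrightarrow> resurrect \<Delta> \<tturnstile> u \<^bold>: U'" for u
      using typ_teq teq_sym by blast
    then show ?thesis using 2(7) Irrelevant by (simp add: rarg_def fun_eq_iff)
  qed
  show ?thesis
    using that[of RT] 2 R unfolding RU by (auto simp: rty_def)
qed

lemma rel_piI:
  assumes "rtype \<Delta> (Pi a s s' U T) (Pi a s s' U' T')" "\<Delta> \<tturnstile> t \<^bold>= t' \<^bold>: Pi a s s' U T"
    and "\<And>u u'. rarg \<Delta> a U U' u u' \<Longrightarrow> rel \<Delta> (inst u T) (inst u' T') (App a t u) (App a t' u')"
  shows "rel \<Delta> (Pi a s s' U T) (Pi a s s' U' T') t t'"
  using assms(1)
proof (rule rtype_piE)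
  fix RT
  assume RT: "\<forall>u u'. rarg \<Delta> a U U' u u' \<longrightarrow> LR (univ \<Delta>) (\<lambda>_. True) \<Delta> (inst u T) (inst u' T') (RT u u')"
    and R: "LR (univ \<Delta>) (\<lambda>_. True) \<Delta> (Pi a s s' U T) (Pi a s s' U' T')
       (\<lambda>t t'. \<Delta> \<tturnstile> t \<^bold>= t' \<^bold>: Pi a s s' U T \<and>
          (\<forall>u u'. rarg \<Delta> a U U' u u' \<longrightarrow> RT u u' (App a t u) (App a t' u')))"
  have "RT u u' (App a t u) (App a t' u')" if u: "rarg \<Delta> a U U' u u'" for u u'
  proof -
    obtain R' where "LR (univ \<Delta>) (\<lambda>_. True) \<Delta> (inst u T) (inst u' T') R'" "R' (App a t u) (App a t' u')"
      using assms(3)[OF u] rel_def by blast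
    then show ?thesis using RT u LR_unique by blast
  qed
  then show ?thesis using R assms(2) unfolding rel_def by blast
qed

lemma rel_pi_app:
  assumes "rel \<Delta> (Pi a s s' U T) (Pi a s s' U' T') t t'" "rarg \<Delta> a U U' u u'"
  shows "rel \<Delta> (inst u T) (inst u' T') (App a t u) (App a t' u')"
  using rel_rtype[OF assms(1)]
proof (rule rtype_piE)
  fix RT
  assume RT: "\<forall>u u'. rarg \<Delta> a U U' u u' \<longrightarrow> LR (univ \<Delta>) (\<lambda>_. True) \<Delta> (inst u T) (inst u' T') (RT u u')"
    and R: "LR (univ \<Delta>) (\<lambda>_. True) \<Delta> (Pi a s s' U T) (Pi a s s' U' T')
       (\<lambda>t t'. \<Delta> \<tturnstile> t \<^bold>= t' \<^bold>: Pi a s s' U T \<and>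
          (\<forall>u u'. rarg \<Delta> a U U' u u' \<longrightarrow> RT u u' (App a t u) (App a t' u')))"
  obtain R' where R': "LR (univ \<Delta>) (\<lambda>_. True) \<Delta> (Pi a s s' U T) (Pi a s s' U' T') R'" "R' t t'"
    using assms(1) rel_def by blast
  have "RT u u' (App a t u) (App a t' u')"
    using LR_unique[OF R'(1) R] R'(2) assms(2) by simp
  then show ?thesis using RT assms(2) unfolding rel_def by blast
qed

lemma rtype_pi_inst:
  "rtype \<Delta> (Pi a s s' U T) (Pi a s s' U' T') \<Longrightarrow> rarg \<Delta> a U U' u u'
    \<Longrightarrow> rtype \<Delta> (inst u T) (inst u' T')"
  by (erule rtype_piE) (auto simp: rty_def)

lemma rarg_sym: "rarg \<Delta> a U U' u u' \<Longrightarrow> rarg \<Delta> a U' U u' u"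
  by (auto simp: rarg_def rel_sym split: ann.splits)

lemma rarg_trans: "rarg \<Delta> a U U' u u' \<Longrightarrow> rarg \<Delta> a U' U'' u' u'' \<Longrightarrow> rarg \<Delta> a U U'' u u''"
  by (auto simp: rarg_def split: ann.splits intro: rel_trans)

lemma rarg_typ:
  assumes "rarg \<Delta> a U U' u u'"
  shows "ctx_for a \<Delta> \<tturnstile> u \<^bold>: U \<and> ctx_for a \<Delta> \<tturnstile> u' \<^bold>: U'"
proof (cases a)
  case Relevant
  then have r: "rel \<Delta> U U' u u'" using assms by (simp add: rarg_def)
  show ?thesis using Relevant rel_cnv[OF r] rel_cnv[OF rel_sym[OF r]] by (auto dest: cnv_valid)
qed (use assms in \<open>simp add: rarg_def\<close>)

definition rsubsts :: "ctx \<Rightarrow> (nat \<Rightarrow> exp) \<Rightarrow> (nat \<Rightarrow> exp) \<Rightarrow> ctx \<Rightarrow> bool" where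
  "rsubsts \<Delta> \<sigma> \<sigma>' \<Gamma> \<longleftrightarrow>
     (\<forall>n a T. lookup \<Gamma> n a T \<longrightarrow> rarg \<Delta> a (sub \<sigma> T) (sub \<sigma>' T) (\<sigma> n) (\<sigma>' n))"

lemma rsubsts_sym: "rsubsts \<Delta> \<sigma> \<sigma>' \<Gamma> \<Longrightarrow> rsubsts \<Delta> \<sigma>' \<sigma> \<Gamma>"
  unfolding rsubsts_def using rarg_sym by blast

lemma rsubsts_refl: "rsubsts \<Delta> \<sigma> \<sigma>' \<Gamma> \<Longrightarrow> rsubsts \<Delta> \<sigma> \<sigma> \<Gamma>"
  unfolding rsubsts_def using rarg_sym rarg_trans by blast

lemma rsubsts_scons:
  "rsubsts \<Delta> \<sigma> \<sigma>' \<Gamma> \<Longrightarrow> rarg \<Delta> a (sub \<sigma> U) (sub \<sigma>' U) u u'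
    \<Longrightarrow> rsubsts \<Delta> (scons u \<sigma>) (scons u' \<sigma>') ((a, U) # \<Gamma>)"
  by (auto simp: rsubsts_def elim!: lookup_ConsE)

lemma rsubsts_substs_eq: "rsubsts \<Delta> \<sigma> \<sigma>' \<Gamma> \<Longrightarrow> substs_eq \<Delta> \<sigma> \<sigma>' \<Gamma>"
  unfolding rsubsts_def substs_eq_def substs_def
  by (metis rarg_typ rel_cnv rarg_def ann.simps(3))

lemma rsubsts_substs: "rsubsts \<Delta> \<sigma> \<sigma>' \<Gamma> \<Longrightarrow> substs \<Delta> \<sigma> \<Gamma> \<and> substs \<Delta> \<sigma>' \<Gamma>"
  by (blast dest: rsubsts_substs_eq[unfolded substs_eq_def])


section \<open>The fundamental theorem\<close>

text \<open>Going under a binder extends the two substitutions by related arguments and leaves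
  \<Delta> as it is, so no change of world occurs inside the relation.\<close>

definition sem :: "ctx \<Rightarrow> exp \<Rightarrow> exp \<Rightarrow> exp \<Rightarrow> bool" where
  "sem \<Gamma> t t' T \<longleftrightarrow> (\<forall>\<Delta> \<sigma> \<sigma>'. \<tturnstile> \<Delta> \<longrightarrow> rsubsts \<Delta> \<sigma> \<sigma>' \<Gamma> \<longrightarrow>
     rel \<Delta> (sub \<sigma> T) (sub \<sigma>' T) (sub \<sigma> t) (sub \<sigma>' t'))"

definition sem_arg :: "ctx \<Rightarrow> ann \<Rightarrow> exp \<Rightarrow> exp \<Rightarrow> exp \<Rightarrow> bool" where
  "sem_arg \<Gamma> a u u' U \<longleftrightarrow> (case a of Relevant \<Rightarrow> sem \<Gamma> u u' U
     | Irrelevant \<Rightarrow> resurrect \<Gamma> \<tturnstile> u \<^bold>: U \<and> resurrect \<Gamma> \<tturnstile> u' \<^bold>: U)"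

lemma semD:
  "sem \<Gamma> t t' T \<Longrightarrow> \<tturnstile> \<Delta> \<Longrightarrow> rsubsts \<Delta> \<sigma> \<sigma>' \<Gamma> \<Longrightarrow> rel \<Delta> (sub \<sigma> T) (sub \<sigma>' T) (sub \<sigma> t) (sub \<sigma>' t')"
  unfolding sem_def by blast

lemma sem_rtype:
  assumes "sem \<Gamma> T T' (Sort s)" "\<tturnstile> \<Delta>" "rsubsts \<Delta> \<sigma> \<sigma>' \<Gamma>"
  shows "rtype \<Delta> (sub \<sigma> T) (sub \<sigma>' T')"
proof -
  obtain i where "s = Set i" by (cases s)
  then show ?thesis using semD[OF assms] rel_sort_rtype by simp
qed

lemma sem_sym: "sem \<Gamma> t t' T \<Longrightarrow> sem \<Gamma> t' t T"
  unfolding sem_def using rel_sym rsubsts_sym by blast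

text \<open>One of the two equations is used at a reflexive pair of substitutions, so that the
  middle terms coincide.\<close>

lemma sem_trans: "sem \<Gamma> t t' T \<Longrightarrow> sem \<Gamma> t' t'' T \<Longrightarrow> sem \<Gamma> t t'' T"
  unfolding sem_def by (meson rel_trans rsubsts_sym rsubsts_refl)

lemma sem_refl: "sem \<Gamma> t t' T \<Longrightarrow> sem \<Gamma> t t T"
  using sem_sym sem_trans by blast

lemma sem_arg_refl: "sem_arg \<Gamma> a u u' U \<Longrightarrow> sem_arg \<Gamma> a u u U"
  by (auto simp: sem_arg_def split: ann.splits intro: sem_refl)

lemma sem_arg_rarg:
  assumes "sem_arg \<Gamma> a u u' U" "\<tturnstile> \<Delta>" "rsubsts \<Delta> \<sigma> \<sigma>' \<Gamma>"
  shows "rarg \<Delta> a (sub \<sigma> U) (sub \<sigma>' U) (sub \<sigma> u) (sub \<sigma>' u')"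
proof (cases a)
  case Relevant
  then show ?thesis using assms semD by (simp add: sem_arg_def rarg_def)
next
  case Irrelevant
  then show ?thesis using assms(1) rsubsts_substs[OF assms(3)] wfc_resurrect[OF assms(2)]
    by (auto simp: sem_arg_def rarg_def intro!: typ_sub substs_resurrect)
qed

lemma sem_conv:
  assumes "sem \<Gamma> t t' T" "sem \<Gamma> T T' (Sort s)"
  shows "sem \<Gamma> t t' T'"
  unfolding sem_def
proof (intro allI impI)
  fix \<Delta> \<sigma> \<sigma>' assume wf: "\<tturnstile> \<Delta>" and r: "rsubsts \<Delta> \<sigma> \<sigma>' \<Gamma>"
  have "rtype \<Delta> (sub \<sigma> T) (sub \<sigma> T')" using sem_rtype[OF assms(2) wf rsubsts_refl[OF r]] .
  moreover have "rtype \<Delta> (sub \<sigma> T') (sub \<sigma>' T')"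
    using sem_rtype[OF sem_refl[OF sem_sym[OF assms(2)]] wf r] .
  ultimately show "rel \<Delta> (sub \<sigma> T') (sub \<sigma>' T') (sub \<sigma> t) (sub \<sigma>' t')"
    using rel_cast semD[OF assms(1) wf r] by blast
qed

text \<open>Domain and codomain are related with universes below \<open>i\<close> and below
  \<open>j\<close>; monotonicity in the bound takes both to \<open>max i j\<close>. The equation of
  the open codomains comes from \<open>cnv_functional\<close>.\<close>

lemma sem_pi:
  assumes U: "\<Gamma> \<tturnstile> U \<^bold>: Sort (Set i)" "\<Gamma> \<tturnstile> U \<^bold>= U' \<^bold>: Sort (Set i)" "sem \<Gamma> U U' (Sort (Set i))"
    and T: "(a, U) # \<Gamma> \<tturnstile> T \<^bold>= T' \<^bold>: Sort (Set j)" "sem ((a, U) # \<Gamma>) T T' (Sort (Set j))"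
  shows "sem \<Gamma> (Pi a (Set i) (Set j) U T) (Pi a (Set i) (Set j) U' T') (Sort (Set (max i j)))"
  unfolding sem_def
proof (intro allI impI)
  fix \<Delta> \<sigma> \<sigma>' assume wf: "\<tturnstile> \<Delta>" and r: "rsubsts \<Delta> \<sigma> \<sigma>' \<Gamma>"
  let ?P = "Pi a (Set i) (Set j) (sub \<sigma> U) (sub (lift_sub \<sigma>) T)"
  let ?P' = "Pi a (Set i) (Set j) (sub \<sigma>' U') (sub (lift_sub \<sigma>') T')"
  have e: "substs_eq \<Delta> \<sigma> \<sigma>' \<Gamma>" and s: "substs \<Delta> \<sigma> \<Gamma>"
    using rsubsts_substs_eq[OF r] rsubsts_substs[OF r] by auto
  have P: "\<Delta> \<tturnstile> ?P \<^bold>= ?P' \<^bold>: Sort (Set (max i j))"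
    using cnv_functional[OF cnv_pi[OF U(1,2) T(1)] wf e] by simp
  have U1: "\<Delta> \<tturnstile> sub \<sigma> U \<^bold>: Sort (Set i)" using typ_sub[OF U(1) wf s] by simp
  have U2: "\<Delta> \<tturnstile> sub \<sigma> U \<^bold>= sub \<sigma>' U \<^bold>: Sort (Set i)" using typ_functional[OF U(1) wf e] by simp
  have "(a, sub \<sigma> U) # \<Delta> \<tturnstile> sub (lift_sub \<sigma>) T \<^bold>= sub (lift_sub \<sigma>') T' \<^bold>: Sort (Set j)"
    using cnv_functional[OF T(1) wfc_extend[OF wf U1] substs_eq_lift[OF e U1 U2]] by simp
  then have T': "teq ((a, sub \<sigma> U) # \<Delta>) (sub (lift_sub \<sigma>) T) (sub (lift_sub \<sigma>') T')"
    by (rule teqI)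
  have relU: "rty (\<lambda>k. k < i) \<Delta> (sub \<sigma> U) (sub \<sigma>' U')"
    using semD[OF U(3) wf r] rel_sort_iff[OF wf] by simp
  have rtU: "rtype \<Delta> (sub \<sigma>' U') (sub \<sigma>' U)"
    using sem_rtype[OF sem_sym[OF U(3)] wf rsubsts_refl[OF rsubsts_sym[OF r]]] .
  have "rty (\<lambda>k. k < max i j) \<Delta> ?P ?P'"
  proof (rule rty_piI)
    show "teq \<Delta> ?P ?P'" using P by (rule teqI)
    show "teq \<Delta> (sub \<sigma> U) (sub \<sigma>' U')" using rty_teq[OF relU] .
    show "rty (\<lambda>k. k < max i j) \<Delta> (sub \<sigma> U) (sub \<sigma>' U')" using rty_mono[OF relU] by simp
  next
    fix u u' assume u: "rarg \<Delta> a (sub \<sigma> U) (sub \<sigma>' U') u u'"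
    \<comment> \<open>The arguments are related over \<open>U\<close> and \<open>U'\<close>, but
      extending the substitutions for the context entry \<open>U\<close> requires \<open>U\<close>
      on both sides.\<close>
    have u: "rarg \<Delta> a (sub \<sigma> U) (sub \<sigma>' U) u u'"
    proof (cases a)
      case Relevant
      then show ?thesis using u rel_sym[OF rel_cast_left[OF rel_sym rtU]] by (simp add: rarg_def)
    next
      case Irrelevant
      then show ?thesis using u typ_teq[OF _ teq_resurrect[OF rty_teq[OF rtU]]] by (simp add: rarg_def)
    qed
    have "rel \<Delta> (Sort (Set j)) (Sort (Set j)) (sub (scons u \<sigma>) T) (sub (scons u' \<sigma>') T')"
      using semD[OF T(2) wf rsubsts_scons[OF r u]] by simp
    then have "rty (\<lambda>k. k < j) \<Delta> (inst u (sub (lift_sub \<sigma>) T)) (inst u' (sub (lift_sub \<sigma>') T'))"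
      using rel_sort_iff[OF wf] by (simp add: inst_sub_lift)
    then show "rty (\<lambda>k. k < max i j) \<Delta> (inst u (sub (lift_sub \<sigma>) T)) (inst u' (sub (lift_sub \<sigma>') T'))"
      by (rule rty_mono) simp
  qed (rule T')
  then show "rel \<Delta> (sub \<sigma> (Sort (Set (max i j)))) (sub \<sigma>' (Sort (Set (max i j))))
      (sub \<sigma> (Pi a (Set i) (Set j) U T)) (sub \<sigma>' (Pi a (Set i) (Set j) U' T'))"
    using P rel_sort_iff[OF wf] by simp
qed

text \<open>Applied to related arguments, both abstractions take one beta step to instances of their
  bodies, which are related by assumption; head expansion on each side leads back. On the right the
  domain is \<open>U'\<close>, hence the conversions of context and argument.\<close>

lemma sem_lam:
  assumes U: "\<Gamma> \<tturnstile> U \<^bold>: Sort s" "\<Gamma> \<tturnstile> U \<^bold>= U' \<^bold>: Sort s" "sem \<Gamma> U U (Sort s)"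
    and T: "(a, U) # \<Gamma> \<tturnstile> T \<^bold>: Sort s'" "sem ((a, U) # \<Gamma>) T T (Sort s')"
    and t: "(a, U) # \<Gamma> \<tturnstile> t \<^bold>= t' \<^bold>: T" "sem ((a, U) # \<Gamma>) t t' T"
  shows "sem \<Gamma> (Lam a U t) (Lam a U' t') (Pi a s s' U T)"
  unfolding sem_def
proof (intro allI impI)
  fix \<Delta> \<sigma> \<sigma>' assume wf: "\<tturnstile> \<Delta>" and r: "rsubsts \<Delta> \<sigma> \<sigma>' \<Gamma>"
  have e: "substs_eq \<Delta> \<sigma> \<sigma>' \<Gamma>" and ss: "substs \<Delta> \<sigma> \<Gamma>" "substs \<Delta> \<sigma>' \<Gamma>"
    using rsubsts_substs_eq[OF r] rsubsts_substs[OF r] by auto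
  obtain i j where ij: "s = Set i" "s' = Set j" by (metis sort.exhaust)
  have "rtype \<Delta> (sub \<sigma> (Pi a s s' U T)) (sub \<sigma>' (Pi a s s' U T))"
    using sem_rtype[OF sem_pi wf r] U T cnv_refl unfolding ij by blast
  moreover have "\<Delta> \<tturnstile> sub \<sigma> (Lam a U t) \<^bold>= sub \<sigma>' (Lam a U' t') \<^bold>: sub \<sigma> (Pi a s s' U T)"
    using cnv_functional[OF cnv_lam[OF U(1,2) T(1) t(1)] wf e] .
  moreover have "rel \<Delta> (inst u (sub (lift_sub \<sigma>) T)) (inst u' (sub (lift_sub \<sigma>') T))
      (App a (sub \<sigma> (Lam a U t)) u) (App a (sub \<sigma>' (Lam a U' t')) u')"
    if u: "rarg \<Delta> a (sub \<sigma> U) (sub \<sigma>' U) u u'" for u u'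
  proof -
    note typs = cnv_valid[OF t(1)]
    have rel: "rel \<Delta> (inst u (sub (lift_sub \<sigma>) T)) (inst u' (sub (lift_sub \<sigma>') T))
      (inst u (sub (lift_sub \<sigma>) t)) (inst u' (sub (lift_sub \<sigma>') t'))"
      using semD[OF t(2) wf rsubsts_scons[OF r u]] by (simp add: inst_sub_lift)
    have U1: "\<Delta> \<tturnstile> sub \<sigma> U \<^bold>: Sort s" using typ_sub[OF U(1) wf ss(1)] by simp
    note wf1 = wfc_extend[OF wf U1] and l1 = substs_lift[OF ss(1) U1]
    have left: "\<Delta> \<tturnstile> App a (sub \<sigma> (Lam a U t)) u \<^bold>= inst u (sub (lift_sub \<sigma>) t) \<^bold>: inst u (sub (lift_sub \<sigma>) T)"
      using cnv_beta[OF U1, of a "sub (lift_sub \<sigma>) T" s'] typ_sub[OF T(1) wf1 l1]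
        typ_sub[OF _ wf1 l1] typs rarg_typ[OF u] by simp
    have U': "\<Gamma> \<tturnstile> U' \<^bold>: Sort s" using U(2) cnv_valid by blast
    have T2: "(a, U') # \<Gamma> \<tturnstile> T \<^bold>: Sort s'" and t2: "(a, U') # \<Gamma> \<tturnstile> t' \<^bold>: T"
      using typ_ctx_conv[OF _ U(2) U'] T(1) typs by blast+
    have U2: "\<Delta> \<tturnstile> sub \<sigma>' U' \<^bold>: Sort s" using typ_sub[OF U' wf ss(2)] by simp
    have "\<Delta> \<tturnstile> sub \<sigma>' U \<^bold>= sub \<sigma>' U' \<^bold>: Sort s" using cnv_sub[OF U(2) wf ss(2)] by simp
    then have u': "ctx_for a \<Delta> \<tturnstile> u' \<^bold>: sub \<sigma>' U'"
      using rarg_typ[OF u] by (blast intro: typ_ctx_for_conv)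
    note wf2 = wfc_extend[OF wf U2] and l2 = substs_lift[OF ss(2) U2]
    have right: "\<Delta> \<tturnstile> App a (sub \<sigma>' (Lam a U' t')) u' \<^bold>= inst u' (sub (lift_sub \<sigma>') t') \<^bold>: inst u' (sub (lift_sub \<sigma>') T)"
      using cnv_beta[OF U2, of a "sub (lift_sub \<sigma>') T" s'] typ_sub[OF T2 wf2 l2]
        typ_sub[OF t2 wf2 l2] u' by simp
    show ?thesis
      using rel_expand_right[OF rel_expand_left[OF rel _ left] _ right] by (simp add: step_beta)
  qed
  ultimately show "rel \<Delta> (sub \<sigma> (Pi a s s' U T)) (sub \<sigma>' (Pi a s s' U T))
      (sub \<sigma> (Lam a U t)) (sub \<sigma>' (Lam a U' t'))"
    by (simp add: rel_piI)
qed

lemma sem_app: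
  assumes t: "sem \<Gamma> t t' (Pi a s s' U T)" and u: "sem_arg \<Gamma> a u u' U"
  shows "sem \<Gamma> (App a t u) (App a t' u') (inst u T)"
  unfolding sem_def
proof (intro allI impI)
  fix \<Delta> \<sigma> \<sigma>' assume wf: "\<tturnstile> \<Delta>" and r: "rsubsts \<Delta> \<sigma> \<sigma>' \<Gamma>"
  have t1: "rel \<Delta> (Pi a s s' (sub \<sigma> U) (sub (lift_sub \<sigma>) T)) (Pi a s s' (sub \<sigma>' U) (sub (lift_sub \<sigma>') T))
     (sub \<sigma> t) (sub \<sigma>' t')" using semD[OF t wf r] by simp
  have "rel \<Delta> (sub \<sigma> (inst u T)) (inst (sub \<sigma>' u') (sub (lift_sub \<sigma>') T))
     (sub \<sigma> (App a t u)) (sub \<sigma>' (App a t' u'))"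
    using rel_pi_app[OF t1 sem_arg_rarg[OF u wf r]] by (simp add: sub_inst_lift)
  \<comment> \<open>The relation above has \<open>u'\<close> in its right type where the goal has
    \<open>u\<close>. Using the function type once more with \<open>u\<close> on both sides relates
    the types required for the cast.\<close>
  moreover have "rtype \<Delta> (sub \<sigma> (inst u T)) (sub \<sigma>' (inst u T))"
    using rtype_pi_inst[OF rel_rtype[OF t1] sem_arg_rarg[OF sem_arg_refl[OF u] wf r]]
    by (simp add: sub_inst_lift)
  ultimately show "rel \<Delta> (sub \<sigma> (inst u T)) (sub \<sigma>' (inst u T)) (sub \<sigma> (App a t u)) (sub \<sigma>' (App a t' u'))"
    using rel_cast rty_refl by blast
qed

lemma sem_beta:
  assumes U: "\<Gamma> \<tturnstile> U \<^bold>: Sort s" and T: "(a, U) # \<Gamma> \<tturnstile> T \<^bold>: Sort s'"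
    and t: "(a, U) # \<Gamma> \<tturnstile> t \<^bold>: T" "sem ((a, U) # \<Gamma>) t t T"
    and u: "ctx_for a \<Gamma> \<tturnstile> u \<^bold>: U" "sem_arg \<Gamma> a u u U"
  shows "sem \<Gamma> (App a (Lam a U t) u) (inst u t) (inst u T)"
  unfolding sem_def
proof (intro allI impI)
  fix \<Delta> \<sigma> \<sigma>' assume wf: "\<tturnstile> \<Delta>" and r: "rsubsts \<Delta> \<sigma> \<sigma>' \<Gamma>"
  have "rel \<Delta> (sub \<sigma> (inst u T)) (sub \<sigma>' (inst u T)) (sub \<sigma> (inst u t)) (sub \<sigma>' (inst u t))"
    using semD[OF t(2) wf rsubsts_scons[OF r sem_arg_rarg[OF u(2) wf r]]] by (simp add: sub_inst)
  moreover have "step (sub \<sigma> (App a (Lam a U t) u)) (sub \<sigma> (inst u t))"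
    using step_beta by (simp add: sub_inst_lift)
  ultimately show "rel \<Delta> (sub \<sigma> (inst u T)) (sub \<sigma>' (inst u T))
      (sub \<sigma> (App a (Lam a U t) u)) (sub \<sigma>' (inst u t))"
    using cnv_sub[OF cnv_beta[OF U T t(1) u(1)] wf] rsubsts_substs[OF r] rel_expand_left by blast
qed

text \<open>The expansion applied to an argument takes one beta step to the original function
  applied to it, so head expansion on the right suffices.\<close>

lemma sem_eta:
  assumes U: "\<Gamma> \<tturnstile> U \<^bold>: Sort s" and T: "(a, U) # \<Gamma> \<tturnstile> T \<^bold>: Sort s'"
    and t: "\<Gamma> \<tturnstile> t \<^bold>: Pi a s s' U T" "sem \<Gamma> t t (Pi a s s' U T)"
  shows "sem \<Gamma> t (Lam a U (App a (ren Suc t) (Var 0))) (Pi a s s' U T)"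
  unfolding sem_def
proof (intro allI impI)
  fix \<Delta> \<sigma> \<sigma>' assume wf: "\<tturnstile> \<Delta>" and r: "rsubsts \<Delta> \<sigma> \<sigma>' \<Gamma>"
  let ?L = "Lam a U (App a (ren Suc t) (Var 0))"
  have ss: "substs \<Delta> \<sigma> \<Gamma>" "substs \<Delta> \<sigma>' \<Gamma>" using rsubsts_substs[OF r] by auto
  have t1: "rel \<Delta> (sub \<sigma> (Pi a s s' U T)) (sub \<sigma>' (Pi a s s' U T)) (sub \<sigma> t) (sub \<sigma>' t)"
    using semD[OF t(2) wf r] .
  have "\<Delta> \<tturnstile> sub \<sigma> t \<^bold>= sub \<sigma>' ?L \<^bold>: sub \<sigma> (Pi a s s' U T)"
    using cnv_functional[OF cnv_eta[OF U T t(1)] wf rsubsts_substs_eq[OF r]] .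
  moreover have "rel \<Delta> (inst u (sub (lift_sub \<sigma>) T)) (inst u' (sub (lift_sub \<sigma>') T))
      (App a (sub \<sigma> t) u) (App a (sub \<sigma>' ?L) u')"
    if u: "rarg \<Delta> a (sub \<sigma> U) (sub \<sigma>' U) u u'" for u u'
  proof -
    have app: "rel \<Delta> (inst u (sub (lift_sub \<sigma>) T)) (inst u' (sub (lift_sub \<sigma>') T))
      (App a (sub \<sigma> t) u) (App a (sub \<sigma>' t) u')"
      using rel_pi_app[of \<Delta> a s s' "sub \<sigma> U" "sub (lift_sub \<sigma>) T"] t1 u by simp
    have U2: "\<Delta> \<tturnstile> sub \<sigma>' U \<^bold>: Sort s" using typ_sub[OF U wf ss(2)] by simp
    have T2: "(a, sub \<sigma>' U) # \<Delta> \<tturnstile> sub (lift_sub \<sigma>') T \<^bold>: Sort s'"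
      using typ_sub[OF T wfc_extend[OF wf U2] substs_lift[OF ss(2) U2]] by simp
    have t2: "\<Delta> \<tturnstile> sub \<sigma>' t \<^bold>: Pi a s s' (sub \<sigma>' U) (sub (lift_sub \<sigma>') T)"
      using typ_sub[OF t(1) wf ss(2)] by simp
    have body: "sub \<sigma>' ?L = Lam a (sub \<sigma>' U) (App a (ren Suc (sub \<sigma>' t)) (Var 0))"
      by (simp add: sub_lift_Suc)
    have inst: "inst u' (App a (ren Suc (sub \<sigma>' t)) (Var 0)) = App a (sub \<sigma>' t) u'"
      by (simp add: inst_scons)
    have "\<Delta> \<tturnstile> App a (sub \<sigma>' ?L) u' \<^bold>= App a (sub \<sigma>' t) u' \<^bold>: inst u' (sub (lift_sub \<sigma>') T)"
      using cnv_beta[OF U2 T2 typ_eta_body[OF U2 T2 t2], of u'] rarg_typ[OF u] unfolding body inst by blast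
    moreover have "step (App a (sub \<sigma>' ?L) u') (App a (sub \<sigma>' t) u')"
      using step_beta[of a _ "App a (ren Suc (sub \<sigma>' t)) (Var 0)" u'] unfolding body inst .
    ultimately show ?thesis using rel_expand_right[OF app] by blast
  qed
  ultimately show "rel \<Delta> (sub \<sigma> (Pi a s s' U T)) (sub \<sigma>' (Pi a s s' U T)) (sub \<sigma> t) (sub \<sigma>' ?L)"
    using rel_rtype[OF t1] by (simp add: rel_piI)
qed

lemma typ_sem: "\<Gamma> \<tturnstile> t \<^bold>: T \<Longrightarrow> sem \<Gamma> t t T"
  and cnv_sem: "\<Gamma> \<tturnstile> t \<^bold>= t' \<^bold>: T \<Longrightarrow> sem \<Gamma> t t' T"
proof (induction rule: wfc_wty_cnv.inducts(2,3)[where ?P1.0="\<lambda>_. True"])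
  case (typ_sort \<Gamma> i)
  have "rel \<Delta> (Sort (Set (Suc i))) (Sort (Set (Suc i))) (Sort (Set i)) (Sort (Set i))"
    if wf: "\<tturnstile> \<Delta>" for \<Delta>
  proof -
    have t: "\<Delta> \<tturnstile> Sort (Set i) \<^bold>: Sort (Set (Suc i))" using wf by (rule wfc_wty_cnv.typ_sort)
    then have "rty (\<lambda>j. j < Suc i) \<Delta> (Sort (Set i)) (Sort (Set i))"
      unfolding rty_def using LR_sort[of "\<lambda>j. j < Suc i" i] red_refl by blast
    then show ?thesis using t rel_sort_iff[OF wf] cnv_refl by blast
  qed
  then show ?case by (simp add: sem_def)
next
  case (typ_pi \<Gamma> U i a T j)
  then show ?case by (blast intro: sem_pi cnv_refl)
next
  case (typ_var \<Gamma> n T)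
  then show ?case by (auto simp: sem_def rsubsts_def rarg_def split: ann.splits)
next
  case (typ_lam \<Gamma> U s a T s' t)
  then show ?case by (blast intro: sem_lam cnv_refl)
next
  case (typ_app \<Gamma> U s a T s' t u)
  then have "sem_arg \<Gamma> a u u U" by (cases a) (auto simp: sem_arg_def)
  with typ_app show ?case by (blast intro: sem_app)
next
  case (typ_conv \<Gamma> t T T' s)
  then show ?case by (blast intro: sem_conv)
next
  case (cnv_beta \<Gamma> U s a T s' t u)
  then have "sem_arg \<Gamma> a u u U" by (cases a) (auto simp: sem_arg_def)
  with cnv_beta show ?case by (blast intro: sem_beta)
next
  case (cnv_eta \<Gamma> U s a T s' t)
  then show ?case by (blast intro: sem_eta)
next
  case (cnv_sym \<Gamma> t t' T)
  then show ?case by (blast intro: sem_sym)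
next
  case (cnv_trans \<Gamma> t1 t2 T t3)
  then show ?case by (blast intro: sem_trans)
next
  case (cnv_pi \<Gamma> U i U' a T T' j)
  then show ?case by (blast intro: sem_pi)
next
  case (cnv_lam \<Gamma> U s U' a T s' t t')
  then show ?case by (blast intro: sem_lam)
next
  case (cnv_app \<Gamma> U s T s' t t' u u')
  then have "sem_arg \<Gamma> Relevant u u' U" by (simp add: sem_arg_def)
  with cnv_app show ?case by (blast intro: sem_app)
next
  case (cnv_app_irr \<Gamma> U s T s' t t' u u')
  then have "sem_arg \<Gamma> Irrelevant u u' U" by (simp add: sem_arg_def)
  with cnv_app_irr show ?case by (blast intro: sem_app)
next
  case (cnv_conv \<Gamma> t t' T T' s)
  then show ?case by (blast intro: sem_conv)
qed simp

text \<open>Generalizes the identity substitution: in an induction on \<Gamma> the tail must still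
  be interpreted in the whole target context, and renamings into a fixed \<Delta> allow that. A
  relevant variable is related to itself once its type is, and this is the fundamental theorem over
  the shorter context.\<close>

lemma rsubsts_renames:
  "\<tturnstile> \<Gamma> \<Longrightarrow> \<tturnstile> \<Delta> \<Longrightarrow> renames \<Delta> \<rho> \<Gamma> \<Longrightarrow> rsubsts \<Delta> (Var \<circ> \<rho>) (Var \<circ> \<rho>) \<Gamma>"
proof (induction \<Gamma> arbitrary: \<rho>)
  case Nil
  then show ?case by (auto simp: rsubsts_def elim: lookup_NilE)
next
  case (Cons X \<Gamma>)
  obtain a U where X: "X = (a, U)" by force
  with Cons.prems obtain s where U: "\<tturnstile> \<Gamma>" "\<Gamma> \<tturnstile> U \<^bold>: Sort s" by (auto elim: wfc_ConsE)
  have \<rho>: "renames \<Delta> (\<rho> \<circ> Suc) \<Gamma>"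
    using Cons.prems(3) lookup_Suc unfolding renames_def by (fastforce simp: ren_ren)
  then have IH: "rsubsts \<Delta> (Var \<circ> (\<rho> \<circ> Suc)) (Var \<circ> (\<rho> \<circ> Suc)) \<Gamma>"
    using Cons.IH U Cons.prems(2) by blast
  have rt: "rtype \<Delta> (ren (\<rho> \<circ> Suc) U) (ren (\<rho> \<circ> Suc) U)"
    using sem_rtype[OF typ_sem[OF U(2)] Cons.prems(2) IH] by (simp add: ren_eq_sub)
  obtain b where b: "lookup \<Delta> (\<rho> 0) b (ren \<rho> (ren Suc U))" "a = Relevant \<longrightarrow> b = Relevant"
    using Cons.prems(3) lookup_0[of a U \<Gamma>] X unfolding renames_def by blast
  have "rarg \<Delta> a (ren (\<rho> \<circ> Suc) U) (ren (\<rho> \<circ> Suc) U) (Var (\<rho> 0)) (Var (\<rho> 0))"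
  proof (cases a)
    case Relevant
    then have "\<Delta> \<tturnstile> Var (\<rho> 0) \<^bold>: ren (\<rho> \<circ> Suc) U"
      using b Cons.prems(2) by (auto simp: ren_ren intro: typ_var)
    then show ?thesis using Relevant rt by (auto simp: rarg_def intro!: rel_neutral neutral_var cnv_refl)
  next
    case Irrelevant
    have "resurrect \<Delta> \<tturnstile> Var (\<rho> 0) \<^bold>: ren (\<rho> \<circ> Suc) U"
      using b Cons.prems(2) by (auto simp: ren_ren intro!: typ_var wfc_resurrect lookup_resurrectI)
    then show ?thesis using Irrelevant by (simp add: rarg_def)
  qed
  then show ?case
    using IH X unfolding rsubsts_def
    by (auto simp: ren_eq_sub[symmetric] ren_ren elim!: lookup_ConsE)
qed

lemma rsubsts_Var: "\<tturnstile> \<Gamma> \<Longrightarrow> rsubsts \<Gamma> Var Var \<Gamma>"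
  using rsubsts_renames[OF _ _ renames_id, of \<Gamma>] by (simp add: comp_def)

text \<open>The fundamental theorem at the identity substitution. Related types compose whatever the
  sorts of the links are, so whole chains pass into the model.\<close>

lemma teq_rtype: "teq \<Gamma> A B \<Longrightarrow> rtype \<Gamma> A B"
proof (induction rule: teq_induct)
  case (base B s)
  then show ?case using sem_rtype[OF cnv_sem cnv_wfc rsubsts_Var[OF cnv_wfc]] by fastforce
next
  case (step B C s)
  then have "rtype \<Gamma> B C"
    using sem_rtype[OF cnv_sem cnv_wfc rsubsts_Var[OF cnv_wfc]] by fastforce
  with step.IH show ?case by (rule rty_trans)
qed


section \<open>Uniqueness of types\<close>

text \<open>The clause for function types imposes one annotation and one pair of sorts on both
  sides, and the right type is its own weak head normal form.\<close>

lemma teq_piD: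
  assumes "teq \<Gamma> (Pi a s s' U T) (Pi b r r' V S)"
  shows "b = a \<and> r = s \<and> r' = s' \<and> teq \<Gamma> U V \<and> teq ((a, U) # \<Gamma>) T S"
proof -
  obtain R where "LR (univ \<Gamma>) (\<lambda>_. True) \<Gamma> (Pi a s s' U T) (Pi b r r' V S) R"
    using teq_rtype[OF assms] rty_def by blast
  then show ?thesis
  proof (rule LR_piD[OF _ rtranclp.rtrancl_refl])
    fix U' T'
    assume eq: "red \<Gamma> (Pi b r r' V S) (Pi a s s' U' T')" "teq \<Gamma> U U'" "teq ((a, U) # \<Gamma>) T T'"
    have "Pi b r r' V S = Pi a s s' U' T'"
      using eq(1) by (intro whnf_unique[of "Pi b r r' V S"]) (auto simp: red_def)
    then show ?thesis using eq by simp
  qed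
qed

lemma teq_sortD:
  assumes "teq \<Gamma> (Sort s) (Sort s')"
  shows "s = s'"
proof -
  obtain i where i: "s = Set i" by (cases s)
  obtain R where "LR (univ \<Gamma>) (\<lambda>_. True) \<Gamma> (Sort (Set i)) (Sort s') R"
    using teq_rtype[OF assms] rty_def i by blast
  then have "red \<Gamma> (Sort s') (Sort (Set i))" using LR_sortD by blast
  then have "Sort s' = Sort (Set i)" by (intro whnf_unique[of "Sort s'"]) (auto simp: red_def)
  then show ?thesis using i by simp
qed

lemma typ_whnf: "\<Gamma> \<tturnstile> A \<^bold>: Sort s \<Longrightarrow> \<exists>W. red \<Gamma> A W \<and> whnf W"
  using teq_rtype[OF teq_refl] LR_whnf unfolding rty_def by blast

lemma typ_teq_refl: "\<Gamma> \<tturnstile> t \<^bold>: T \<Longrightarrow> teq \<Gamma> T T"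
  by (blast dest: typ_valid intro: teq_refl)

section \<open>Inversion of typing up to chains of equations\<close>

lemma typ_sort_inv: "\<Gamma> \<tturnstile> Sort (Set i) \<^bold>: X \<Longrightarrow> teq \<Gamma> (Sort (Set (Suc i))) X"
proof (induction \<Gamma> "Sort (Set i)" X rule: wfc_wty_cnv.inducts(2)[where ?P1.0="\<lambda>_. True" and ?P3.0="\<lambda>_ _ _ _. True"])
  case (typ_sort \<Gamma>)
  then show ?case using typ_teq_refl wfc_wty_cnv.typ_sort by blast
next
  case (typ_conv \<Gamma> T T' s)
  then show ?case by (blast intro: teq_trans teqI)
qed auto

lemma typ_pi_sort_inv:
  "\<Gamma> \<tturnstile> Pi a (Set i) (Set j) U T \<^bold>: X \<Longrightarrow> teq \<Gamma> (Sort (Set (max i j))) X"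
proof (induction \<Gamma> "Pi a (Set i) (Set j) U T" X rule: wfc_wty_cnv.inducts(2)[where ?P1.0="\<lambda>_. True" and ?P3.0="\<lambda>_ _ _ _. True"])
  case (typ_pi \<Gamma>)
  then show ?case using typ_teq_refl wfc_wty_cnv.typ_pi by blast
next
  case (typ_conv \<Gamma> T T' s)
  then show ?case by (blast intro: teq_trans teqI)
qed auto

lemma typ_var_inv: "\<Gamma> \<tturnstile> Var n \<^bold>: X \<Longrightarrow> \<exists>T. lookup \<Gamma> n Relevant T \<and> teq \<Gamma> T X"
proof (induction \<Gamma> "Var n" X rule: wfc_wty_cnv.inducts(2)[where ?P1.0="\<lambda>_. True" and ?P3.0="\<lambda>_ _ _ _. True"])
  case (typ_var \<Gamma> T)
  then show ?case using typ_teq_refl wfc_wty_cnv.typ_var by blast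
next
  case (typ_conv \<Gamma> T T' s)
  then show ?case by (blast intro: teq_trans teqI)
qed auto

lemma typ_lam_inv:
  "\<Gamma> \<tturnstile> Lam a U t \<^bold>: X \<Longrightarrow> \<exists>s s' T. \<Gamma> \<tturnstile> U \<^bold>: Sort s \<and> (a, U) # \<Gamma> \<tturnstile> T \<^bold>: Sort s' \<and>
    (a, U) # \<Gamma> \<tturnstile> t \<^bold>: T \<and> teq \<Gamma> (Pi a s s' U T) X"
proof (induction \<Gamma> "Lam a U t" X rule: wfc_wty_cnv.inducts(2)[where ?P1.0="\<lambda>_. True" and ?P3.0="\<lambda>_ _ _ _. True"])
  case (typ_lam \<Gamma> s T s')
  then show ?case using typ_teq_refl wfc_wty_cnv.typ_lam by blast
next
  case (typ_conv \<Gamma> T T' s)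
  then show ?case by (meson teq_trans teqI)
qed auto

lemma typ_app_inv:
  "\<Gamma> \<tturnstile> App a t u \<^bold>: X \<Longrightarrow> \<exists>s s' U T. \<Gamma> \<tturnstile> U \<^bold>: Sort s \<and> (a, U) # \<Gamma> \<tturnstile> T \<^bold>: Sort s' \<and>
    \<Gamma> \<tturnstile> t \<^bold>: Pi a s s' U T \<and> ctx_for a \<Gamma> \<tturnstile> u \<^bold>: U \<and> teq \<Gamma> (inst u T) X"
proof (induction \<Gamma> "App a t u" X rule: wfc_wty_cnv.inducts(2)[where ?P1.0="\<lambda>_. True" and ?P3.0="\<lambda>_ _ _ _. True"])
  case (typ_app \<Gamma> U s T s')
  have h: "\<Gamma> \<tturnstile> U \<^bold>: Sort s" "(a, U) # \<Gamma> \<tturnstile> T \<^bold>: Sort s'" "\<Gamma> \<tturnstile> t \<^bold>: Pi a s s' U T"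
    "ctx_for a \<Gamma> \<tturnstile> u \<^bold>: U" by (fact typ_app.hyps)+
  have "teq \<Gamma> (inst u T) (inst u T)" using typ_teq_refl[OF wfc_wty_cnv.typ_app[OF h]] .
  with h show ?case by (intro exI conjI)
next
  case (typ_conv \<Gamma> T T' s)
  then show ?case by (meson teq_trans teqI)
qed auto

text \<open>In the beta case the abstraction has its own function type and the one at which it is
  applied. Injectivity equates their domains, which retypes the argument, and their codomains, which
  retypes the result.\<close>

lemma step_typ: "step t t' \<Longrightarrow> \<Gamma> \<tturnstile> t \<^bold>: X \<Longrightarrow> \<Gamma> \<tturnstile> t' \<^bold>: X"
proof (induction arbitrary: X rule: step.induct)
  case (step_beta a U t u)
  obtain s s' V S where app: "\<Gamma> \<tturnstile> Lam a U t \<^bold>: Pi a s s' V S" "ctx_for a \<Gamma> \<tturnstile> u \<^bold>: V" "teq \<Gamma> (inst u S) X"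
    using typ_app_inv[OF step_beta] by blast
  obtain r r' T where lam: "(a, U) # \<Gamma> \<tturnstile> t \<^bold>: T" "teq \<Gamma> (Pi a r r' U T) (Pi a s s' V S)"
    using typ_lam_inv[OF app(1)] by blast
  have UV: "teq \<Gamma> U V" and TS: "teq ((a, U) # \<Gamma>) T S" using teq_piD[OF lam(2)] by auto
  have u: "ctx_for a \<Gamma> \<tturnstile> u \<^bold>: U" using typ_teq[OF app(2) teq_ctx_for[OF teq_sym[OF UV]]] .
  have "\<Gamma> \<tturnstile> inst u t \<^bold>: inst u T" using typ_inst[OF lam(1) u] .
  then show ?case using teq_inst[OF TS u] app(3) typ_teq by blast
next
  case (step_app t t' a u)
  obtain s s' U T where app: "\<Gamma> \<tturnstile> U \<^bold>: Sort s" "(a, U) # \<Gamma> \<tturnstile> T \<^bold>: Sort s'"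
    "\<Gamma> \<tturnstile> t \<^bold>: Pi a s s' U T" "ctx_for a \<Gamma> \<tturnstile> u \<^bold>: U" "teq \<Gamma> (inst u T) X"
    using typ_app_inv[OF step_app.prems] by blast
  show ?case using typ_teq[OF typ_app[OF app(1,2) step_app.IH[OF app(3)] app(4)] app(5)] .
qed

lemma steps_typ: "step\<^sup>*\<^sup>* t t' \<Longrightarrow> \<Gamma> \<tturnstile> t \<^bold>: X \<Longrightarrow> \<Gamma> \<tturnstile> t' \<^bold>: X"
  by (induction rule: rtranclp_induct) (blast intro: step_typ)+

section \<open>Uniqueness of types, from normal forms to all terms\<close>

lemma lookup_unique: "lookup \<Gamma> n a T \<Longrightarrow> lookup \<Gamma> n b T' \<Longrightarrow> T = T'"
  by (auto simp: lookup_nth)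

lemma typ_Sort_unique: "\<Gamma> \<tturnstile> Sort s \<^bold>: X \<Longrightarrow> \<Gamma> \<tturnstile> Sort s \<^bold>: Y \<Longrightarrow> teq \<Gamma> X Y"
  by (cases s) (blast intro: teq_trans[OF teq_sym] typ_sort_inv)

lemma typ_Pi_unique:
  "\<Gamma> \<tturnstile> Pi a s s' U T \<^bold>: X \<Longrightarrow> \<Gamma> \<tturnstile> Pi a s s' U T \<^bold>: Y \<Longrightarrow> teq \<Gamma> X Y"
  by (cases s; cases s') (blast intro: teq_trans[OF teq_sym] typ_pi_sort_inv)

lemma typ_var_unique: "\<Gamma> \<tturnstile> Var n \<^bold>: X \<Longrightarrow> \<Gamma> \<tturnstile> Var n \<^bold>: Y \<Longrightarrow> teq \<Gamma> X Y"
  by (metis typ_var_inv lookup_unique teq_sym teq_trans)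

text \<open>Uniqueness is assumed for the function alone, so that the lemma serves neutral terms
  first and the induction over all terms later.\<close>

lemma typ_app_unique:
  assumes "\<And>X Y. \<Gamma> \<tturnstile> t \<^bold>: X \<Longrightarrow> \<Gamma> \<tturnstile> t \<^bold>: Y \<Longrightarrow> teq \<Gamma> X Y"
    and "\<Gamma> \<tturnstile> App a t u \<^bold>: X" "\<Gamma> \<tturnstile> App a t u \<^bold>: Y"
  shows "teq \<Gamma> X Y"
proof -
  obtain s s' U T where X: "\<Gamma> \<tturnstile> t \<^bold>: Pi a s s' U T" "ctx_for a \<Gamma> \<tturnstile> u \<^bold>: U" "teq \<Gamma> (inst u T) X"
    using typ_app_inv[OF assms(2)] by blast
  obtain r r' V S where Y: "\<Gamma> \<tturnstile> t \<^bold>: Pi a r r' V S" "teq \<Gamma> (inst u S) Y"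
    using typ_app_inv[OF assms(3)] by blast
  have "teq ((a, U) # \<Gamma>) T S" using teq_piD[OF assms(1)[OF X(1) Y(1)]] by blast
  then have "teq \<Gamma> (inst u T) (inst u S)" using X(2) by (rule teq_inst)
  then show ?thesis using X(3) Y(2) by (meson teq_sym teq_trans)
qed

lemma typ_neutral_unique: "neutral t \<Longrightarrow> \<Gamma> \<tturnstile> t \<^bold>: X \<Longrightarrow> \<Gamma> \<tturnstile> t \<^bold>: Y \<Longrightarrow> teq \<Gamma> X Y"
  by (induction arbitrary: X Y rule: neutral.induct) (blast intro: typ_var_unique typ_app_unique)+

text \<open>A weak head normal form in the sense of \<open>whnf\<close> is never an abstraction.
  This avoids the one case whose uniqueness proof already relies on unique sorts, those of its
  domain and codomain.\<close>

lemma typ_sort_unique: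
  assumes "\<Gamma> \<tturnstile> A \<^bold>: Sort s" "\<Gamma> \<tturnstile> A \<^bold>: Sort s'"
  shows "s = s'"
proof -
  obtain W where "red \<Gamma> A W" "whnf W" using typ_whnf[OF assms(1)] by blast
  then have W: "\<Gamma> \<tturnstile> W \<^bold>: Sort s" "\<Gamma> \<tturnstile> W \<^bold>: Sort s'"
    using assms steps_typ by (auto simp: red_def)
  from \<open>whnf W\<close> consider r where "W = Sort r" | a r r' U T where "W = Pi a r r' U T" | "neutral W"
    by (auto simp: whnf_def)
  then have "teq \<Gamma> (Sort s) (Sort s')"
  proof cases
    case 1
    then show ?thesis using W typ_Sort_unique by blast
  next
    case 2
    then show ?thesis using W typ_Pi_unique by blast
  next
    case 3
    then show ?thesis using W typ_neutral_unique by blast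
  qed
  then show ?thesis by (rule teq_sortD)
qed

text \<open>Neighbouring links share a type, which has a single sort, so ordinary transitivity
  applies.\<close>

lemma teq_cnv: "teq \<Gamma> A B \<Longrightarrow> \<exists>s. \<Gamma> \<tturnstile> A \<^bold>= B \<^bold>: Sort s"
proof (induction rule: teq_induct)
  case (step B C s)
  then obtain r where "\<Gamma> \<tturnstile> A \<^bold>= B \<^bold>: Sort r" by blast
  moreover from this have "r = s" using step.hyps(2) typ_sort_unique cnv_valid by blast
  ultimately show ?case using step.hyps(2) cnv_trans by blast
qed blast

lemma typ_unique: "\<Gamma> \<tturnstile> t \<^bold>: X \<Longrightarrow> \<Gamma> \<tturnstile> t \<^bold>: Y \<Longrightarrow> teq \<Gamma> X Y"
proof (induction t arbitrary: \<Gamma> X Y)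
  case (Sort s)
  then show ?case by (rule typ_Sort_unique)
next
  case (Pi a s s' U T)
  from Pi.prems show ?case by (rule typ_Pi_unique)
next
  case (Var n)
  then show ?case by (rule typ_var_unique)
next
  case (Lam a U t)
  obtain s s' T where X: "\<Gamma> \<tturnstile> U \<^bold>: Sort s" "(a, U) # \<Gamma> \<tturnstile> T \<^bold>: Sort s'"
    "(a, U) # \<Gamma> \<tturnstile> t \<^bold>: T" "teq \<Gamma> (Pi a s s' U T) X"
    using typ_lam_inv[OF Lam.prems(1)] by blast
  obtain r r' S where Y: "\<Gamma> \<tturnstile> U \<^bold>: Sort r" "(a, U) # \<Gamma> \<tturnstile> S \<^bold>: Sort r'"
    "(a, U) # \<Gamma> \<tturnstile> t \<^bold>: S" "teq \<Gamma> (Pi a r r' U S) Y"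
    using typ_lam_inv[OF Lam.prems(2)] by blast
  obtain q where q: "(a, U) # \<Gamma> \<tturnstile> T \<^bold>= S \<^bold>: Sort q"
    using teq_cnv[OF Lam.IH(2)[OF X(3) Y(3)]] by blast
  have "r = s" using typ_sort_unique[OF Y(1) X(1)] .
  \<comment> \<open>\<open>q\<close> is merely the sort at which the codomains happen to be equal;
    \<open>cnv_pi\<close> requires it to be the sort annotated in both function types.\<close>
  moreover have "q = s'" "q = r'" using q X(2) Y(2) typ_sort_unique cnv_valid by blast+
  moreover obtain i j where "s = Set i" "s' = Set j" by (metis sort.exhaust)
  ultimately have "teq \<Gamma> (Pi a s s' U T) (Pi a r r' U S)"
    using cnv_pi[OF X(1)[unfolded \<open>s = Set i\<close>] cnv_refl] X(1) q by (blast intro: teqI)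
  then show ?case using X(4) Y(4) by (meson teq_sym teq_trans)
next
  case (App a t u)
  then show ?case using typ_app_unique by blast
qed

theorem theorem5p8:
  fixes \<Gamma> :: ctx and t T T' :: exp
  assumes "\<Gamma> \<turnstile> t \<^bold>: T"
    and "\<Gamma> \<turnstile> t \<^bold>: T'"
  shows "\<Gamma> \<turnstile> T \<^bold>= T'"
  using teq_cnv[OF typ_unique] assms has_type_imp cnv_imp unfolding eq_ty_def by blast

end
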